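(* Suppose that $\widehat A\neq(\widehat A)^*$ is a maximal dissipative extension of a closed, densely defined symmetric operator $\dot A$ with deficiency indices $(1,1)$, and that $A$ is a self-adjoint extension of $\dot A$. Suppose that the deficiency elements $g_\pm\in\operatorname{Ker}((\dot A)^*\mp iI)$ are normalized, $\|g_\pm\|=1$, and chosen in such a way that $g_+-g_-\in\operatorname{Dom}(A)$ and $g_+-\kappa g_-\in\operatorname{Dom}(\widehat A)$ for some $|\kappa|<1$. Then the following resolvent formula holds: $$(\widehat A-zI)^{-1}=(A-zI)^{-1}-p(z)\,(\cdot\,,g_{\overline z})\,g_z,\qquad z\in\rho(\widehat A)\cap\rho(A).$$ Here: (a) $$p(z)=\left(M(\dot A,A)(z)+i\,\frac{\kappa+1}{\kappa-1}\right)^{-1}=i\left(\frac{s(\dot A,A)(z)+1}{s(\dot A,A)(z)-1}-\frac{\kappa+1}{\kappa-1}\right)^{-1};$$ (b) $M(\dot A,A)$ and $s(\dot A,A)$ are the Weyl–Titchmarsh function and the Livšic function of the pair $(\dot A,A)$, respectively; (c) $g_z$ are deficiency elements of $\dot A$, $g_z\in\operatorname{Ker}((\dot A)^*-zI)$, satisfying the normalization condition $$\|g_z\|=\left(\int_{\mathbb R}\frac{d\mu(\lambda)}{|\lambda-z|^2}\right)^{1/2}$$ (the deficiency elements $g_z$ can be chosen to be analytic in $z\in\rho(\widehat A)\cap\rho(A)$); (d) $\mu$ is the measure from the Herglotz–Nevanlinna representation $$M(\dot A,A)(z)=\int_{\mathbb R}\left(\frac{1}{\lambda-z}-\frac{\lambda}{1+\lambda^2}\right)d\mu(\lambda);$$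 (e) $\kappa$ is the von Neumann parameter characterizing the domain of the dissipative extension $\widehat A$, $$g_i-g_{-i}\in\operatorname{Dom}(A)\quad\text{and}\quad g_i-\kappa g_{-i}\in\operatorname{Dom}(\widehat A).$$
   Context: $\mathbb C_+$ is the open upper half-plane, $\rho(\cdot)$ denotes the resolvent set, and inner products are linear in the first argument. A maximal dissipative extension $\widehat A$ of $\dot A$ satisfies $\dot A\subset\widehat A\subset(\dot A)^*$ and $\operatorname{Im}(\widehat Af,f)\ge0$ for $f\in\operatorname{Dom}(\widehat A)$. With $g_\pm$ as in the claim (normalized, $g_+-g_-\in\operatorname{Dom}(A)$), the Weyl–Titchmarsh function of the pair $(\dot A,A)$ is $$M(\dot A,A)(z)=((Az+I)(A-zI)^{-1}g_+,g_+),\qquad z\in\mathbb C_+,$$ continued to the lower half-plane by the Schwarz reflection principle, $M(\dot A,A)(z)=\overline{M(\dot A,A)(\overline z)}$. The measure $\mu$ in its Herglotz–Nevanlinna representation is an infinite Borel measure on $\mathbb R$ with $\int_{\mathbb R}\frac{d\mu(\lambda)}{1+\lambda^2}=1$. The Livšic function of the pair is $$s(\dot A,A)(z)=\frac{z-i}{z+i}\cdot\frac{(h_z,g_-)}{(h_z,g_+)},\qquad z\in\mathbb C_+,$$ where $0\ne h_z\in\operatorname{Ker}((\dot A)^*-zI)$ is an arbitrary deficiency element. *)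

theory Defs
  imports "HOL-Analysis.Analysis"
begin

text \<open>Complex Hilbert spaces, with the inner product linear in the first argument. The real inner
  product of the superclass is the real part of the complex one, so that
  norm x = sqrt (Re (cinner x x)).\<close>

class complex_hilbert_space = real_inner + complete_space +
  fixes scaleC :: "complex \<Rightarrow> 'a \<Rightarrow> 'a" (infixr "*\<^sub>C" 75)
    and cinner :: "'a \<Rightarrow> 'a \<Rightarrow> complex"
  assumes scaleC_add_right: "a *\<^sub>C (x + y) = a *\<^sub>C x + a *\<^sub>C y"
    and scaleC_add_left: "(a + b) *\<^sub>C x = a *\<^sub>C x + b *\<^sub>C x"
    and scaleC_scaleC: "a *\<^sub>C (b *\<^sub>C x) = (a * b) *\<^sub>C x"
    and scaleC_one: "1 *\<^sub>C x = x"
    and scaleR_scaleC: "r *\<^sub>R x = complex_of_real r *\<^sub>C x"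
    and cinner_commute: "cinner x y = cnj (cinner y x)"
    and cinner_add_left: "cinner (x + y) z = cinner x z + cinner y z"
    and cinner_scaleC_left: "cinner (a *\<^sub>C x) y = a * cinner x y"
    and inner_Re_cinner: "inner x y = Re (cinner x y)"

global_interpretation complex_vector:
  vector_space "scaleC :: complex \<Rightarrow> 'a \<Rightarrow> 'a::complex_hilbert_space"
  by unfold_locales (simp_all add: scaleC_add_right scaleC_add_left scaleC_scaleC scaleC_one)

text \<open>Unbounded operators are represented by their graphs: the domain is \<^const>\<open>Domain\<close>, extension of
  operators is inclusion, and equality of operators is equality of sets.\<close>

type_synonym 'a opgraph = "('a \<times> 'a) set"

definition linear_operator :: "'a::complex_hilbert_space opgraph \<Rightarrow> bool" where
  "linear_operator T \<longleftrightarrow> single_valued T \<and> (0, 0) \<in> T \<and>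
     (\<forall>x x' y y' a. (x, x') \<in> T \<longrightarrow> (y, y') \<in> T \<longrightarrow> (a *\<^sub>C x + y, a *\<^sub>C x' + y') \<in> T)"

definition op_apply :: "'a opgraph \<Rightarrow> 'a \<Rightarrow> 'a" where
  "op_apply T x = (THE y. (x, y) \<in> T)"

definition densely_defined :: "'a::complex_hilbert_space opgraph \<Rightarrow> bool" where
  "densely_defined T \<longleftrightarrow> closure (Domain T) = UNIV"

definition adjoint :: "'a::complex_hilbert_space opgraph \<Rightarrow> 'a opgraph" where
  "adjoint T = {(y, y'). \<forall>(x, x') \<in> T. cinner x' y = cinner x y'}"

definition symmetric_operator :: "'a::complex_hilbert_space opgraph \<Rightarrow> bool" where
  "symmetric_operator T \<longleftrightarrow> linear_operator T \<and> densely_defined T \<and>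
     (\<forall>(x, x') \<in> T. \<forall>(y, y') \<in> T. cinner x' y = cinner x y')"

definition self_adjoint :: "'a::complex_hilbert_space opgraph \<Rightarrow> bool" where
  "self_adjoint T \<longleftrightarrow> linear_operator T \<and> densely_defined T \<and> adjoint T = T"

definition dissipative :: "'a::complex_hilbert_space opgraph \<Rightarrow> bool" where
  "dissipative T \<longleftrightarrow> linear_operator T \<and> densely_defined T \<and> (\<forall>(x, x') \<in> T. Im (cinner x' x) \<ge> 0)"

definition maximal_dissipative :: "'a::complex_hilbert_space opgraph \<Rightarrow> bool" where
  "maximal_dissipative T \<longleftrightarrow> dissipative T \<and> (\<forall>S. dissipative S \<longrightarrow> T \<subseteq> S \<longrightarrow> S = T)"

definition maximal_dissipative_extension ::
    "'a::complex_hilbert_space opgraph \<Rightarrow> 'a opgraph \<Rightarrow> bool" where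
  "maximal_dissipative_extension S T \<longleftrightarrow> maximal_dissipative T \<and> S \<subseteq> T \<and> T \<subseteq> adjoint S"

text \<open>The deficiency subspace Ker(T* - zI).\<close>

definition deficiency_space :: "'a::complex_hilbert_space opgraph \<Rightarrow> complex \<Rightarrow> 'a set" where
  "deficiency_space T z = {h. (h, z *\<^sub>C h) \<in> adjoint T}"

definition has_cdim :: "'a::complex_hilbert_space set \<Rightarrow> nat \<Rightarrow> bool" where
  "has_cdim V n \<longleftrightarrow> (\<exists>B. finite B \<and> card B = n \<and> complex_vector.independent B \<and>
     complex_vector.span B = V)"

definition has_deficiency_indices :: "'a::complex_hilbert_space opgraph \<Rightarrow> nat \<Rightarrow> nat \<Rightarrow> bool" where
  "has_deficiency_indices T m n \<longleftrightarrow>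
     has_cdim (deficiency_space T \<i>) m \<and> has_cdim (deficiency_space T (- \<i>)) n"

text \<open>The graph of the inverse relation of T - zI; it is the graph of an everywhere defined bounded
  operator exactly when z is in the resolvent set.\<close>

definition resolvent_graph :: "'a::complex_hilbert_space opgraph \<Rightarrow> complex \<Rightarrow> 'a opgraph" where
  "resolvent_graph T z = {(x' - z *\<^sub>C x, x) |x x'. (x, x') \<in> T}"

definition resolvent_set :: "'a::complex_hilbert_space opgraph \<Rightarrow> complex set" where
  "resolvent_set T = {z. \<exists>R. bounded_linear R \<and> resolvent_graph T z = {(y, R y) |y. True}}"

definition resolvent :: "'a::complex_hilbert_space opgraph \<Rightarrow> complex \<Rightarrow> 'a \<Rightarrow> 'a" where
  "resolvent T z = op_apply (resolvent_graph T z)"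

text \<open>Complex differentiability in norm at every point of S, which for open S (such as resolvent
  sets) is analyticity.\<close>

definition vector_analytic_on :: "(complex \<Rightarrow> 'a::complex_hilbert_space) \<Rightarrow> complex set \<Rightarrow> bool" where
  "vector_analytic_on g S \<longleftrightarrow>
     (\<forall>z\<in>S. \<exists>d. ((\<lambda>w. inverse (w - z) *\<^sub>C (g w - g z)) \<longlongrightarrow> d) (at z))"

text \<open>The function z \<mapsto> ((zA + I)(A - zI)^{-1} g, g), continued to the lower half-plane by Schwarz
  reflection. At real points of the resolvent set of A the same formula gives the analytic
  continuation from the half-planes.\<close>

definition weyl_titchmarsh :: "'a::complex_hilbert_space opgraph \<Rightarrow> 'a \<Rightarrow> complex \<Rightarrow> complex" where
  "weyl_titchmarsh A g z =
     (let M = (\<lambda>w. let u = resolvent A w g in cinner (w *\<^sub>C op_apply A u + u) g)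
      in if Im z < 0 then cnj (M (cnj z)) else M z)"

definition deficiency_element :: "'a::complex_hilbert_space opgraph \<Rightarrow> complex \<Rightarrow> 'a" where
  "deficiency_element T z = (SOME h. h \<noteq> 0 \<and> h \<in> deficiency_space T z)"

text \<open>The quotient does not depend on the choice of the deficiency element, the deficiency spaces
  being one-dimensional. The defining formula is used at every z in the resolvent set of A, not only
  in the upper half-plane; below the real axis it is the reflection s(z) = 1 / cnj (s (cnj z)),
  which is infinite where the denominator vanishes, as it always does at z = -i.\<close>

definition livsic :: "'a::complex_hilbert_space opgraph \<Rightarrow> 'a \<Rightarrow> 'a \<Rightarrow> complex \<Rightarrow> complex" where
  "livsic T gp gm z =
     (let h = deficiency_element T z in (z - \<i>) / (z + \<i>) * (cinner h gm / cinner h gp))"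

definition livsic_infinite :: "'a::complex_hilbert_space opgraph \<Rightarrow> 'a \<Rightarrow> complex \<Rightarrow> bool" where
  "livsic_infinite T gp z \<longleftrightarrow> (z + \<i>) * cinner (deficiency_element T z) gp = 0"

definition herglotz_nevanlinna_measure ::
    "complex set \<Rightarrow> (complex \<Rightarrow> complex) \<Rightarrow> real measure \<Rightarrow> bool" where
  "herglotz_nevanlinna_measure S M \<mu> \<longleftrightarrow>
     sets \<mu> = sets borel \<and> emeasure \<mu> UNIV = \<infinity> \<and>
     integrable \<mu> (\<lambda>t. 1 / (1 + t\<^sup>2)) \<and> (LINT t|\<mu>. 1 / (1 + t\<^sup>2)) = 1 \<and>
     (\<forall>z\<in>S. integrable \<mu> (\<lambda>t. 1 / (of_real t - z) - of_real (t / (1 + t\<^sup>2))) \<and>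
        M z = (LINT t|\<mu>. 1 / (of_real t - z) - of_real (t / (1 + t\<^sup>2))))"

end

theory Submission
  imports Defs "HOL-Probability.Probability"
begin

text \<open>
  The deficiency elements are g(z) = (A - i)(A - z)^{-1} g_+. They lie in Ker(Adot* - z), depend
  analytically on z, and take the values g_+ at i and g_- at -i, the latter because
  g_+ - g_- is in the domain of A. Two identities tie them to the Weyl--Titchmarsh function M:
  M(z) + i = (z + i) (g(z), g_+) and the Pick identity
  M(z) - cnj M(w) = (z - cnj w) (g(z), g(w)). From the latter, Im M(z) = Im z |g(z)|^2.

  The resolvent formula is linear algebra modulo the domain of Adot. That domain is
  the set of u in the domain of A with (A + i)u orthogonal to g_+ (\<open>mem_dot_if_orthogonal\<close>: the range
  of Adot + i is closed and its complement is spanned by g_+). Hence u = (A - z)^{-1} f and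
  g(z) are explicit combinations of g_+ and g_- modulo this domain, with coefficients (f, g(cnj z))
  and M(z) up to constants, and exactly one multiple c makes u - c g(z) proportional to
  g_+ - \<kappa> g_-, that is, an element of the domain of Ahat. This c is p(z) (f, g(cnj z)); if its
  denominator vanished, g(z) would be an eigenvector of Ahat. The expression through the
  Livsic function follows from s = (M - i)/(M + i), which is the Pick identity with w = -i.

  The measure is obtained without a spectral theorem. The Cayley transform V = (A + i)(A - i)^{-1} is
  an isometry, so the Fejer means of the Fourier series with coefficients (V^n g_+, g_+) are
  squared norms; they are densities of probability measures on one period, and a weak limit point
  has exactly these moments (\<open>trigonometric_moments\<close>). As the range of V - 1 is the domain of
  A, which is dense, the mean ergodic theorem excludes mass at 1, and t = i (w + 1)/(w - 1)
  carries the measure to a probability measure \<nu> on the line. Summing a geometric series gives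
  M(z) as the integral of (1 + t z)/(t - z) d\<nu>, first in the upper half-plane, then below it
  by conjugation and at real points of the resolvent set by monotone and dominated
  convergence. The measure of the theorem is d\<mu> = (1 + t^2) d\<nu>. Comparing
  imaginary parts with Im M(z) = Im z |g(z)|^2 gives the norms of g(z). If \<mu> were finite, the vectors
  n g(in) would be bounded, which forces g_+ into the domain of A
  (\<open>deficiency_vector_bounded_imp_domain\<close>) and makes it an eigenvector of A for i.
\<close>

section \<open>Complex inner products\<close>

lemma cinner_add_right: "cinner x (y + z) = cinner x y + cinner x z"
  by (metis cinner_add_left cinner_commute complex_cnj_add)

lemma cinner_scaleC_right: "cinner x (a *\<^sub>C y) = cnj a * cinner x y"
  by (metis cinner_commute cinner_scaleC_left complex_cnj_mult)

lemma cinner_zero_left [simp]: "cinner 0 y = 0"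
  using cinner_add_left[of 0 0 y] by simp

lemma cinner_zero_right [simp]: "cinner x 0 = 0"
  using cinner_add_right[of x 0 0] by simp

lemma cinner_minus_left [simp]: "cinner (- x) y = - cinner x y"
  using cinner_add_left[of x "- x" y] by (simp add: eq_neg_iff_add_eq_0 add.commute)

lemma cinner_minus_right [simp]: "cinner x (- y) = - cinner x y"
  using cinner_add_right[of x y "- y"] by (simp add: eq_neg_iff_add_eq_0 add.commute)

lemma cinner_diff_left: "cinner (x - y) z = cinner x z - cinner y z"
  using cinner_add_left[of x "- y" z] by simp

lemma cinner_diff_right: "cinner x (y - z) = cinner x y - cinner x z"
  using cinner_add_right[of x y "- z"] by simp

lemmas cinner_linear =
  cinner_add_left cinner_add_right cinner_diff_left cinner_diff_right
  cinner_scaleC_left cinner_scaleC_right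

lemma cinner_sum_left: "cinner (\<Sum>i\<in>I. f i) y = (\<Sum>i\<in>I. cinner (f i) y)"
  by (induction I rule: infinite_finite_induct) (simp_all add: cinner_add_left)

lemma cinner_sum_right: "cinner x (\<Sum>i\<in>I. f i) = (\<Sum>i\<in>I. cinner x (f i))"
  by (induction I rule: infinite_finite_induct) (simp_all add: cinner_add_right)

lemma cinner_self: "cinner x x = complex_of_real ((norm x)\<^sup>2)"
proof -
  have "Im (cinner x x) = 0"
    using cinner_commute[of x x] by (simp add: complex_eq_iff)
  then show ?thesis
    by (simp add: complex_eq_iff power2_norm_eq_inner inner_Re_cinner)
qed

lemma norm_scaleC: "norm (a *\<^sub>C x) = cmod a * norm x"
proof -
  have "complex_of_real ((norm (a *\<^sub>C x))\<^sup>2) = complex_of_real ((cmod a * norm x)\<^sup>2)"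
    by (simp only: cinner_self[symmetric] cinner_linear)
      (simp add: cinner_self power_mult_distrib complex_norm_square[symmetric]
        mult.commute[of "cnj a" a] flip: mult.assoc)
  then show ?thesis
    unfolding of_real_eq_iff by (simp add: power2_eq_iff_nonneg)
qed

lemma cinner_norm_le: "cmod (cinner x y) \<le> norm x * norm y"
proof (cases "cinner x y = 0")
  case False
  define a where "a = cnj (sgn (cinner x y))"
  have "a * cinner x y = cmod (cinner x y)"
    using False
    by (simp add: a_def sgn_eq mult.commute[of "cnj _"] complex_norm_square[symmetric])
      (simp add: power2_eq_square)
  then have "cmod (cinner x y) = inner (a *\<^sub>C x) y"
    by (simp add: inner_Re_cinner cinner_scaleC_left)
  also have "\<dots> \<le> norm (a *\<^sub>C x) * norm y"
    by (rule norm_cauchy_schwarz)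
  also have "norm (a *\<^sub>C x) = norm x"
    using False by (simp add: norm_scaleC a_def norm_sgn)
  finally show ?thesis .
qed simp

lemma bounded_bilinear_cinner: "bounded_bilinear cinner"
proof
  show "\<exists>K. \<forall>(x::'a) y. norm (cinner x y) \<le> norm x * norm y * K"
    by (rule exI[of _ 1]) (simp add: cinner_norm_le)
qed (simp_all only: cinner_linear scaleR_scaleC complex_cnj_complex_of_real scaleR_conv_of_real)

lemma bounded_bilinear_scaleC: "bounded_bilinear scaleC"
proof
  show "\<exists>K. \<forall>a (x::'a). norm (a *\<^sub>C x) \<le> norm a * norm x * K"
    by (rule exI[of _ 1]) (simp add: norm_scaleC)
qed (simp_all only: scaleC_add_left scaleC_add_right scaleR_scaleC scaleC_scaleC
    scaleR_conv_of_real mult.commute)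

lemmas tendsto_cinner = bounded_bilinear.tendsto[OF bounded_bilinear_cinner]
lemmas tendsto_scaleC = bounded_bilinear.tendsto[OF bounded_bilinear_scaleC]

lemmas scaleC_simps =
  scaleC_add_left scaleC_add_right scaleC_scaleC scaleC_one
  complex_vector.scale_left_diff_distrib complex_vector.scale_right_diff_distrib

text \<open>The sequence minimising the distance from x to S is Cauchy by the parallelogram law.\<close>

lemma nearest_point_exists:
  fixes S :: "'a::complex_hilbert_space set"
  assumes "closed S" and sub: "complex_vector.subspace S"
  obtains p where "p \<in> S" "\<And>s. s \<in> S \<Longrightarrow> norm (x - p) \<le> norm (x - s)"
proof -
  define D where "D = (\<lambda>s. (norm (x - s))\<^sup>2) ` S"
  define d where "d = Inf D"
  have "0 \<in> S" using sub by (simp add: complex_vector.subspace_def)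
  then have D: "D \<noteq> {}" "bdd_below D"
    by (auto simp: D_def intro!: bdd_belowI[of _ 0])
  have lower: "d \<le> (norm (x - s))\<^sup>2" if "s \<in> S" for s
    unfolding d_def using D that by (intro cInf_lower) (auto simp: D_def)
  have "\<exists>s\<in>S. (norm (x - s))\<^sup>2 < d + 1 / Suc n" for n
    using cInf_lessD[OF D(1), of "d + 1 / Suc n"] by (auto simp: d_def D_def)
  then obtain s where s: "\<And>n. s n \<in> S" "\<And>n. (norm (x - s n))\<^sup>2 < d + 1 / Suc n"
    by metis
  have est: "(norm (s m - s n))\<^sup>2 \<le> 2 / Suc m + 2 / Suc n" for m n
  proof -
    have "(1/2) *\<^sub>R (s m + s n) \<in> S"
      using s(1) sub by (simp add: scaleR_scaleC complex_vector.subspace_def)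
    from lower[OF this]
    have "4 * d \<le> (norm (2 *\<^sub>R (x - (1/2) *\<^sub>R (s m + s n))))\<^sup>2"
      by (simp add: power_mult_distrib)
    also have "2 *\<^sub>R (x - (1/2) *\<^sub>R (s m + s n)) = (x - s m) + (x - s n)"
      by (simp add: algebra_simps scaleR_2)
    finally have "4 * d \<le> (norm ((x - s m) + (x - s n)))\<^sup>2" .
    moreover have "(norm ((x - s m) + (x - s n)))\<^sup>2 + (norm (s m - s n))\<^sup>2
        = 2 * (norm (x - s m))\<^sup>2 + 2 * (norm (x - s n))\<^sup>2"
      by (simp add: power2_norm_eq_inner algebra_simps inner_commute)
    ultimately show ?thesis
      using s(2)[of m] s(2)[of n] by simp
  qed
  have "Cauchy s"
  proof (rule CauchyI)
    fix e :: real assume "0 < e"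
    then have "0 < e\<^sup>2 / 4" by simp
    from nat_approx_posE[OF this] obtain k where k: "1 / real (Suc k) < e\<^sup>2 / 4"
      by (auto simp: field_simps)
    show "\<exists>M. \<forall>m\<ge>M. \<forall>n\<ge>M. norm (s m - s n) < e"
    proof (intro exI allI impI)
      fix m n assume mn: "k \<le> m" "k \<le> n"
      have "1 / real (Suc m) \<le> 1 / real (Suc k)" "1 / real (Suc n) \<le> 1 / real (Suc k)"
        using mn by (simp_all add: field_simps)
      with k have "2 / real (Suc m) + 2 / real (Suc n) < e\<^sup>2" by simp
      with est[of m n] have "(norm (s m - s n))\<^sup>2 < e\<^sup>2" by simp
      with \<open>0 < e\<close> show "norm (s m - s n) < e"
        by (intro power2_less_imp_less[of "norm (s m - s n)" e]) auto
    qed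
  qed
  then obtain p where p: "s \<longlonglongrightarrow> p"
    using Cauchy_convergent convergent_def by blast
  have "p \<in> S"
    using closed_sequentially[OF \<open>closed S\<close> s(1) p] .
  moreover have "norm (x - p) \<le> norm (x - t)" if "t \<in> S" for t
  proof -
    have "(\<lambda>n. (norm (x - s n))\<^sup>2) \<longlonglongrightarrow> (norm (x - p))\<^sup>2"
      by (intro tendsto_intros p)
    moreover have "(\<lambda>n. d + 1 / Suc n) \<longlonglongrightarrow> d + 0"
      by (intro tendsto_intros LIMSEQ_Suc[OF lim_const_over_n])
    ultimately have "(norm (x - p))\<^sup>2 \<le> d + 0"
      by (rule LIMSEQ_le) (use s(2) less_imp_le in blast)
    with lower[OF that] have "(norm (x - p))\<^sup>2 \<le> (norm (x - t))\<^sup>2" by linarith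
    then show ?thesis
      by (rule power2_le_imp_le) simp
  qed
  ultimately show ?thesis using that by blast
qed

text \<open>The difference of x and its nearest point in S is orthogonal to S, since otherwise moving along
  S would bring the point closer to x; being orthogonal to x as well, it is zero.\<close>

lemma closed_subspace_double_orthogonal:
  fixes S :: "'a::complex_hilbert_space set"
  assumes "closed S" and sub: "complex_vector.subspace S"
    and orth: "\<And>v. (\<And>s. s \<in> S \<Longrightarrow> cinner s v = 0) \<Longrightarrow> cinner x v = 0"
  shows "x \<in> S"
proof -
  obtain p where p: "p \<in> S" "\<And>s. s \<in> S \<Longrightarrow> norm (x - p) \<le> norm (x - s)"
    using nearest_point_exists[OF assms(1) sub, of x] by blast
  define v where "v = x - p"
  have perp: "cinner s v = 0" if "s \<in> S" for s
  proof (cases "s = 0")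
    case False
    \<comment> \<open>moving by the projection of v onto the line through s lowers the distance most\<close>
    define a where "a = cinner v s / (norm s)\<^sup>2"
    have "p + a *\<^sub>C s \<in> S"
      using p(1) that sub by (simp add: complex_vector.subspace_def)
    from p(2)[OF this] have "norm v \<le> norm (v - a *\<^sub>C s)"
      by (simp add: v_def algebra_simps)
    then have "(norm v)\<^sup>2 \<le> (norm (v - a *\<^sub>C s))\<^sup>2"
      by (simp add: power_mono)
    moreover have "complex_of_real ((norm (v - a *\<^sub>C s))\<^sup>2)
        = (norm v)\<^sup>2 - cinner v s * cinner s v / (norm s)\<^sup>2"
      unfolding cinner_self[symmetric]
      using False by (simp add: cinner_linear cinner_self[of s] a_def field_simps power2_eq_square
          flip: cinner_commute[of s v])
    moreover have "cinner v s * cinner s v = complex_of_real ((cmod (cinner s v))\<^sup>2)"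
      by (metis cinner_commute complex_norm_square mult.commute)
    ultimately have "complex_of_real ((norm (v - a *\<^sub>C s))\<^sup>2)
        = complex_of_real ((norm v)\<^sup>2 - (cmod (cinner s v))\<^sup>2 / (norm s)\<^sup>2)"
      by simp
    then have "(norm (v - a *\<^sub>C s))\<^sup>2 = (norm v)\<^sup>2 - (cmod (cinner s v))\<^sup>2 / (norm s)\<^sup>2"
      by (simp only: of_real_eq_iff)
    with \<open>(norm v)\<^sup>2 \<le> (norm (v - a *\<^sub>C s))\<^sup>2\<close>
    have "(cmod (cinner s v))\<^sup>2 / (norm s)\<^sup>2 \<le> 0"
      by simp
    with False show ?thesis by (simp add: divide_le_0_iff)
  qed simp
  have "cinner v v = 0"
    using orth[of v] perp perp[OF p(1)] by (simp add: v_def cinner_diff_left)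
  then have "v = 0" by (simp add: cinner_self)
  with p(1) show ?thesis by (simp add: v_def)
qed

section \<open>Linear operators as graphs and their resolvents\<close>

lemma op_apply_eq: "single_valued T \<Longrightarrow> (x, y) \<in> T \<Longrightarrow> op_apply T x = y"
  unfolding op_apply_def by (rule the_equality) (auto dest: single_valuedD)

lemma linear_operator_comb:
  "linear_operator T \<Longrightarrow> (x, x') \<in> T \<Longrightarrow> (y, y') \<in> T \<Longrightarrow> (a *\<^sub>C x + y, a *\<^sub>C x' + y') \<in> T"
  unfolding linear_operator_def by blast

lemma linear_operator_scale:
  assumes "linear_operator T" "(x, x') \<in> T"
  shows "(a *\<^sub>C x, a *\<^sub>C x') \<in> T"
proof -
  have "(0, 0) \<in> T" using assms(1) unfolding linear_operator_def by blast
  from linear_operator_comb[OF assms this] show ?thesis by simp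
qed

lemma linear_operator_add:
  "linear_operator T \<Longrightarrow> (x, x') \<in> T \<Longrightarrow> (y, y') \<in> T \<Longrightarrow> (x + y, x' + y') \<in> T"
  using linear_operator_comb[of T x x' y y' 1] by (simp add: scaleC_one)

lemma linear_operator_diff:
  assumes "linear_operator T" "(x, x') \<in> T" "(y, y') \<in> T"
  shows "(x - y, x' - y') \<in> T"
  using linear_operator_comb[OF assms(1,3,2), of "-1"] by (simp add: scaleC_one)

lemma adjoint_comb:
  assumes "(x, x') \<in> adjoint T" "(y, y') \<in> adjoint T"
  shows "(a *\<^sub>C x + y, a *\<^sub>C x' + y') \<in> adjoint T"
  using assms by (fastforce simp: adjoint_def cinner_linear)

lemma adjoint_scale: "(x, x') \<in> adjoint T \<Longrightarrow> (a *\<^sub>C x, a *\<^sub>C x') \<in> adjoint T"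
  by (fastforce simp: adjoint_def cinner_linear)

lemma adjoint_diff:
  "(x, x') \<in> adjoint T \<Longrightarrow> (y, y') \<in> adjoint T \<Longrightarrow> (x - y, x' - y') \<in> adjoint T"
  by (fastforce simp: adjoint_def cinner_linear)

lemma adjoint_antimono: "S \<subseteq> T \<Longrightarrow> adjoint T \<subseteq> adjoint S"
  by (fastforce simp: adjoint_def)

lemma orthogonal_dense_eq_0:
  assumes "closure D = UNIV" "\<And>x. x \<in> D \<Longrightarrow> cinner x v = 0"
  shows "v = 0"
proof -
  have "v \<in> closure D" using assms(1) by simp
  then obtain x where x: "\<And>n. x n \<in> D" "x \<longlonglongrightarrow> v"
    unfolding closure_sequential by blast
  have "(\<lambda>n. cinner (x n) v) \<longlonglongrightarrow> cinner v v"
    by (intro tendsto_cinner x tendsto_const)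
  with assms(2) x(1) have "cinner v v = 0"
    by (simp add: LIMSEQ_const_iff)
  then show ?thesis by (simp add: cinner_self)
qed

lemma adjoint_unique:
  assumes "densely_defined T" "(x, y) \<in> adjoint T" "(x, y') \<in> adjoint T"
  shows "y = y'"
proof -
  have "cinner u (y - y') = 0" if "u \<in> Domain T" for u
    using that assms(2,3) by (fastforce simp: adjoint_def cinner_diff_right)
  with assms(1) have "y - y' = 0"
    unfolding densely_defined_def by (rule orthogonal_dense_eq_0)
  then show ?thesis by simp
qed

lemma mem_resolvent_graph: "(f, u) \<in> resolvent_graph T z \<longleftrightarrow> (u, f + z *\<^sub>C u) \<in> T"
  by (auto simp: resolvent_graph_def intro: exI[of _ "f + z *\<^sub>C u"])

lemma resolvent_set_resolvent:
  assumes "z \<in> resolvent_set T"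
  shows "bounded_linear (resolvent T z)"
    and "(u, f + z *\<^sub>C u) \<in> T \<longleftrightarrow> u = resolvent T z f"
proof -
  obtain R where R: "bounded_linear R" "resolvent_graph T z = {(y, R y) |y. True}"
    using assms by (auto simp: resolvent_set_def)
  then have "resolvent T z = R"
    by (auto simp: resolvent_def op_apply_def fun_eq_iff)
  with R show "bounded_linear (resolvent T z)"
    and "(u, f + z *\<^sub>C u) \<in> T \<longleftrightarrow> u = resolvent T z f"
    using mem_resolvent_graph[of f u T z] by auto
qed

lemma resolvent_in_graph:
  "z \<in> resolvent_set T \<Longrightarrow> (resolvent T z f, f + z *\<^sub>C resolvent T z f) \<in> T"
  using resolvent_set_resolvent(2) by blast

lemma resolvent_eqI:
  "z \<in> resolvent_set T \<Longrightarrow> (u, u') \<in> T \<Longrightarrow> u' = f + z *\<^sub>C u \<Longrightarrow> resolvent T z f = u"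
  using resolvent_set_resolvent(2)[of z T u f] by simp

lemma resolvent_add:
  "z \<in> resolvent_set T \<Longrightarrow> resolvent T z (f + h) = resolvent T z f + resolvent T z h"
  by (rule linear_add[OF bounded_linear.linear[OF resolvent_set_resolvent(1)]])

lemma resolvent_diff:
  "z \<in> resolvent_set T \<Longrightarrow> resolvent T z (f - h) = resolvent T z f - resolvent T z h"
  by (rule linear_diff[OF bounded_linear.linear[OF resolvent_set_resolvent(1)]])

lemma resolvent_scale:
  assumes "linear_operator T" "z \<in> resolvent_set T"
  shows "resolvent T z (a *\<^sub>C f) = a *\<^sub>C resolvent T z f"
  by (rule resolvent_eqI[OF assms(2) linear_operator_scale[OF assms(1) resolvent_in_graph[OF assms(2)]]])
    (simp add: scaleC_simps mult.commute)

lemma resolvent_identity: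
  assumes "linear_operator T" "z \<in> resolvent_set T" "w \<in> resolvent_set T"
  shows "resolvent T w f = resolvent T z f + (w - z) *\<^sub>C resolvent T w (resolvent T z f)"
proof (rule resolvent_eqI[OF assms(3)])
  define u where "u = resolvent T z f"
  define v where "v = resolvent T w u"
  have "(u, f + z *\<^sub>C u) \<in> T" "(v, u + w *\<^sub>C v) \<in> T"
    using assms by (simp_all add: u_def v_def resolvent_in_graph)
  then have "((w - z) *\<^sub>C v + u, (w - z) *\<^sub>C (u + w *\<^sub>C v) + (f + z *\<^sub>C u)) \<in> T"
    by (intro linear_operator_comb assms)
  then show "(resolvent T z f + (w - z) *\<^sub>C resolvent T w (resolvent T z f),
      (w - z) *\<^sub>C (u + w *\<^sub>C v) + (f + z *\<^sub>C u)) \<in> T"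
    by (simp add: u_def v_def add.commute)
  show "(w - z) *\<^sub>C (u + w *\<^sub>C v) + (f + z *\<^sub>C u)
      = f + w *\<^sub>C (resolvent T z f + (w - z) *\<^sub>C resolvent T w (resolvent T z f))"
    unfolding u_def[symmetric] v_def[symmetric]
    by (simp add: scaleC_simps algebra_simps)
qed

lemma eigenvector_eq_0:
  assumes "z \<in> resolvent_set T" "(h, z *\<^sub>C h) \<in> T" "linear_operator T"
  shows "h = 0"
proof -
  have "(0, 0) \<in> T" using assms(3) by (simp add: linear_operator_def)
  then have "resolvent T z 0 = 0" by (rule resolvent_eqI[OF assms(1)]) simp
  moreover have "resolvent T z 0 = h" by (rule resolvent_eqI[OF assms(1,2)]) simp
  ultimately show ?thesis by simp
qed

section \<open>Resolvents of self-adjoint operators\<close>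

text \<open>This is (A - i)(A - z)^{-1} g. If g lies in the deficiency space at i of a symmetric restriction
  of A, the vector lies in the deficiency space at z.\<close>

definition deficiency_vector :: "'a::complex_hilbert_space opgraph \<Rightarrow> 'a \<Rightarrow> complex \<Rightarrow> 'a" where
  "deficiency_vector A g z = g + (z - \<i>) *\<^sub>C resolvent A z g"

context
  fixes A :: "'a::complex_hilbert_space opgraph"
  assumes sa: "self_adjoint A"
begin

lemma sa_linear: "linear_operator A"
  and sa_dense: "densely_defined A"
  and sa_adjoint: "adjoint A = A"
  using sa by (auto simp: self_adjoint_def)

lemma sa_symmetric: "(x, x') \<in> A \<Longrightarrow> (y, y') \<in> A \<Longrightarrow> cinner x' y = cinner x y'"
  using sa_adjoint unfolding adjoint_def by blast

lemma sa_closed: "((\<lambda>n. x n) \<longlonglongrightarrow> y) \<Longrightarrow> (\<lambda>n. x' n) \<longlonglongrightarrow> y' \<Longrightarrow> (\<And>n. (x n, x' n) \<in> A) \<Longrightarrow> (y, y') \<in> A"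
proof -
  assume lim: "x \<longlonglongrightarrow> y" "x' \<longlonglongrightarrow> y'" and A: "\<And>n. (x n, x' n) \<in> A"
  have "cinner v' y = cinner v y'" if "(v, v') \<in> A" for v v'
  proof (rule LIMSEQ_unique)
    show "(\<lambda>n. cinner v' (x n)) \<longlonglongrightarrow> cinner v' y"
      by (intro tendsto_cinner lim tendsto_const)
    have "(\<lambda>n. cinner v (x' n)) \<longlonglongrightarrow> cinner v y'"
      by (intro tendsto_cinner lim tendsto_const)
    then show "(\<lambda>n. cinner v' (x n)) \<longlonglongrightarrow> cinner v y'"
      using sa_symmetric[OF that A] by simp
  qed
  then have "(y, y') \<in> adjoint A" unfolding adjoint_def by blast
  then show ?thesis using sa_adjoint by simp
qed

text \<open>A - Re z is symmetric, so the cross terms with the skew part - i Im z cancel.\<close>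

lemma sa_shift_norm:
  assumes "(x, x') \<in> A"
  shows "(norm (x' - z *\<^sub>C x))\<^sup>2 = (norm (x' - complex_of_real (Re z) *\<^sub>C x))\<^sup>2 + (Im z)\<^sup>2 * (norm x)\<^sup>2"
proof -
  have z: "z = complex_of_real (Re z) + \<i> * complex_of_real (Im z)"
    "cnj z = complex_of_real (Re z) - \<i> * complex_of_real (Im z)"
    by (simp_all add: complex_eq_iff)
  have "cinner x' x = cinner x x'" using sa_symmetric assms by blast
  then have "cinner (x' - z *\<^sub>C x) (x' - z *\<^sub>C x)
      = cinner (x' - complex_of_real (Re z) *\<^sub>C x) (x' - complex_of_real (Re z) *\<^sub>C x)
        + complex_of_real ((Im z)\<^sup>2) * cinner x x"
    unfolding cinner_linear complex_cnj_complex_of_real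
    by (subst (1 2) z) (simp add: z(2) algebra_simps power2_eq_square)
  then show ?thesis
    unfolding cinner_self of_real_mult[symmetric] of_real_add[symmetric] of_real_eq_iff .
qed

lemma sa_shift_norm_cnj:
  assumes "(x, x') \<in> A"
  shows "norm (x' - cnj z *\<^sub>C x) = norm (x' - z *\<^sub>C x)"
proof -
  have "(norm (x' - cnj z *\<^sub>C x))\<^sup>2 = (norm (x' - z *\<^sub>C x))\<^sup>2"
    using sa_shift_norm[OF assms, of z] sa_shift_norm[OF assms, of "cnj z"] by simp
  then show ?thesis by (simp add: power2_eq_iff_nonneg)
qed

text \<open>A lower bound on A - z makes its range closed, and a vector orthogonal to the range is an
  eigenvector for the conjugate of z, hence zero because A - z and A - cnj z have equal norms.\<close>

lemma sa_bounded_below: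
  assumes "0 < c" and below: "\<And>x x'. (x, x') \<in> A \<Longrightarrow> c * norm x \<le> norm (x' - z *\<^sub>C x)"
  shows "z \<in> resolvent_set A" and "c * norm (resolvent A z f) \<le> norm f"
proof -
  define S where "S = Domain (resolvent_graph A z)"
  have S: "f \<in> S \<longleftrightarrow> (\<exists>x. (x, f + z *\<^sub>C x) \<in> A)" for f
    by (auto simp: S_def mem_resolvent_graph Domain_iff)
  have below': "c * norm x \<le> norm f" if "(x, f + z *\<^sub>C x) \<in> A" for x f
    using below[OF that] by simp
  have comb: "(a *\<^sub>C x + y, (a *\<^sub>C f + h) + z *\<^sub>C (a *\<^sub>C x + y)) \<in> A"
    if "(x, f + z *\<^sub>C x) \<in> A" "(y, h + z *\<^sub>C y) \<in> A" for a x y f h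
    using linear_operator_comb[OF sa_linear that, of a] by (simp add: scaleC_simps algebra_simps)
  have zero: "(0, 0 + z *\<^sub>C 0) \<in> A"
    using sa_linear by (simp add: linear_operator_def)
  have uniq: "x = y" if "(x, f + z *\<^sub>C x) \<in> A" "(y, f + z *\<^sub>C y) \<in> A" for x y f
    using below'[of "x - y" 0] comb[OF that(2,1), of "-1"] \<open>0 < c\<close>
    by (simp add: scaleC_one algebra_simps mult_le_0_iff)
  have "complex_vector.subspace S"
    unfolding complex_vector.subspace_def
  proof (intro conjI ballI allI)
    show "0 \<in> S" using zero S by blast
    show "f + h \<in> S" if fh: "f \<in> S" "h \<in> S" for f h
    proof -
      obtain x y where "(x, f + z *\<^sub>C x) \<in> A" "(y, h + z *\<^sub>C y) \<in> A"
        using fh S by blast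
      from comb[OF this, of 1] show ?thesis
        unfolding S by (intro exI[of _ "x + y"]) (simp add: scaleC_one)
    qed
    show "a *\<^sub>C f \<in> S" if f: "f \<in> S" for a f
    proof -
      obtain x where "(x, f + z *\<^sub>C x) \<in> A" using f S by blast
      from comb[OF this zero, of a] show ?thesis
        unfolding S by (intro exI[of _ "a *\<^sub>C x"]) simp
    qed
  qed
  moreover have "closed S"
    unfolding closed_sequential_limits
  proof (intro allI impI, elim conjE)
    fix s l assume "\<forall>n. s n \<in> S" and s: "s \<longlonglongrightarrow> l"
    then obtain x where x: "\<And>n. (x n, s n + z *\<^sub>C x n) \<in> A"
      unfolding S by metis
    have "Cauchy x"
    proof (rule CauchyI)
      fix e :: real assume "0 < e"
      then have "0 < c * e" using \<open>0 < c\<close> by simp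
      then obtain N where N: "\<And>m n. N \<le> m \<Longrightarrow> N \<le> n \<Longrightarrow> norm (s m - s n) < c * e"
        using LIMSEQ_imp_Cauchy[OF s] CauchyD by metis
      have "norm (x m - x n) < e" if "N \<le> m" "N \<le> n" for m n
      proof -
        have "c * norm (x m - x n) \<le> norm (s m - s n)"
          using below'[OF comb[OF x x, of "-1" n m]] by (simp add: scaleC_one)
        also have "\<dots> < c * e" using N that by blast
        finally show ?thesis using \<open>0 < c\<close> by simp
      qed
      then show "\<exists>N. \<forall>m\<ge>N. \<forall>n\<ge>N. norm (x m - x n) < e" by blast
    qed
    then obtain y where y: "x \<longlonglongrightarrow> y" using Cauchy_convergent convergent_def by blast
    have "(\<lambda>n. s n + z *\<^sub>C x n) \<longlonglongrightarrow> l + z *\<^sub>C y"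
      by (intro tendsto_add tendsto_scaleC s y tendsto_const)
    from sa_closed[OF y this x] show "l \<in> S" unfolding S by blast
  qed
  moreover have "v = 0" if v: "\<And>s. s \<in> S \<Longrightarrow> cinner s v = 0" for v
  proof -
    have "cinner x' v = cinner x (cnj z *\<^sub>C v)" if "(x, x') \<in> A" for x x'
    proof -
      have "x' - z *\<^sub>C x \<in> S" unfolding S using that by (intro exI[of _ x]) simp
      from v[OF this] show ?thesis by (simp add: cinner_linear)
    qed
    then have "(v, cnj z *\<^sub>C v) \<in> adjoint A" unfolding adjoint_def by blast
    then have "(v, cnj z *\<^sub>C v) \<in> A" using sa_adjoint by simp
    from below[OF this] sa_shift_norm_cnj[OF this, of z] have "c * norm v \<le> 0"
      by (simp only: diff_self norm_zero)
    with \<open>0 < c\<close> show "v = 0" by (simp add: mult_le_0_iff)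
  qed
  ultimately have surj: "f \<in> S" for f
    using closed_subspace_double_orthogonal[of S f] by fastforce
  then obtain R where R: "\<And>f. (R f, f + z *\<^sub>C R f) \<in> A"
    unfolding S by metis
  have bl: "bounded_linear R"
  proof (rule bounded_linear_intro[of R "1/c"])
    show "R (f + h) = R f + R h" for f h
      using uniq[OF R] comb[OF R R, of 1 f h] by (simp add: scaleC_one)
    show "R (r *\<^sub>R f) = r *\<^sub>R R f" for r f
      using uniq[OF R] comb[OF R zero, of "complex_of_real r" f] by (simp add: scaleR_scaleC)
    show "norm (R f) \<le> norm f * (1 / c)" for f
      using below'[OF R, of f] \<open>0 < c\<close> by (simp add: field_simps)
  qed
  have "resolvent_graph A z = {(y, R y) |y. True}"
    using uniq[OF R] R by (auto simp: mem_resolvent_graph)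
  with bl show z: "z \<in> resolvent_set A" by (auto simp: resolvent_set_def)
  show "c * norm (resolvent A z f) \<le> norm f"
    using below'[OF resolvent_in_graph[OF z]] .
qed

lemma sa_nonreal_resolvent:
  assumes "Im z \<noteq> 0"
  shows "z \<in> resolvent_set A"
proof (rule sa_bounded_below(1))
  show "\<bar>Im z\<bar> * norm x \<le> norm (x' - z *\<^sub>C x)" if "(x, x') \<in> A" for x x'
  proof (rule power2_le_imp_le)
    show "(\<bar>Im z\<bar> * norm x)\<^sup>2 \<le> (norm (x' - z *\<^sub>C x))\<^sup>2"
      unfolding sa_shift_norm[OF that, of z] power_mult_distrib power2_abs by simp
  qed simp
qed (use assms in auto)

lemma sa_resolvent_below:
  assumes "z \<in> resolvent_set A"
  obtains c where "0 < c" "\<And>x x'. (x, x') \<in> A \<Longrightarrow> c * norm x \<le> norm (x' - z *\<^sub>C x)"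
proof -
  obtain K where K: "0 < K" "\<And>f. norm (resolvent A z f) \<le> norm f * K"
    using bounded_linear.pos_bounded[OF resolvent_set_resolvent(1)[OF assms]] by blast
  have "1 / K * norm x \<le> norm (x' - z *\<^sub>C x)" if "(x, x') \<in> A" for x x'
  proof -
    have "resolvent A z (x' - z *\<^sub>C x) = x"
      by (rule resolvent_eqI[OF assms that]) simp
    with K(2)[of "x' - z *\<^sub>C x"] K(1) show ?thesis by (simp add: field_simps)
  qed
  with K(1) show ?thesis using that[of "1 / K"] by simp
qed

lemma sa_cnj_resolvent_set: "z \<in> resolvent_set A \<Longrightarrow> cnj z \<in> resolvent_set A"
proof -
  assume "z \<in> resolvent_set A"
  from sa_resolvent_below[OF this] obtain c where
    "0 < c" "\<And>x x'. (x, x') \<in> A \<Longrightarrow> c * norm x \<le> norm (x' - z *\<^sub>C x)" by blast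
  then show ?thesis
    using sa_bounded_below(1)[of c "cnj z"] sa_shift_norm_cnj by simp
qed

lemma sa_resolvent_adjoint:
  assumes "z \<in> resolvent_set A"
  shows "cinner (resolvent A z f) h = cinner f (resolvent A (cnj z) h)"
  using sa_symmetric[OF resolvent_in_graph[OF assms, of f]
      resolvent_in_graph[OF sa_cnj_resolvent_set[OF assms], of h]]
  by (simp add: cinner_linear)

lemma sa_resolvent_near:
  assumes "z \<in> resolvent_set A"
  obtains c where "0 < c" "\<And>w. dist w z < c \<Longrightarrow> w \<in> resolvent_set A"
    "\<And>w f. dist w z < c \<Longrightarrow> c * norm (resolvent A w f) \<le> norm f"
proof -
  obtain d where d: "0 < d" "\<And>x x'. (x, x') \<in> A \<Longrightarrow> d * norm x \<le> norm (x' - z *\<^sub>C x)"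
    using sa_resolvent_below[OF assms] by blast
  define c where "c = d / 2"
  have "c * norm x \<le> norm (x' - w *\<^sub>C x)" if "dist w z < c" "(x, x') \<in> A" for w x x'
  proof -
    have "norm (x' - z *\<^sub>C x) \<le> norm (x' - w *\<^sub>C x) + norm ((w - z) *\<^sub>C x)"
      using norm_triangle_ineq[of "x' - w *\<^sub>C x" "(w - z) *\<^sub>C x"] by (simp add: scaleC_simps)
    moreover have "norm ((w - z) *\<^sub>C x) \<le> c * norm x"
      using that(1) by (simp add: norm_scaleC dist_norm mult_right_mono)
    ultimately show ?thesis using d(2)[OF that(2)] by (simp add: c_def)
  qed
  moreover have "0 < c" using d(1) by (simp add: c_def)
  ultimately show ?thesis using that sa_bounded_below by meson
qed

lemma sa_resolvent_continuous:
  assumes "z \<in> resolvent_set A"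
  shows "((\<lambda>w. resolvent A w f) \<longlongrightarrow> resolvent A z f) (at z)"
proof -
  obtain c where c: "0 < c" "\<And>w. dist w z < c \<Longrightarrow> w \<in> resolvent_set A"
    "\<And>w f. dist w z < c \<Longrightarrow> c * norm (resolvent A w f) \<le> norm f"
    using sa_resolvent_near[OF assms] by metis
  have ev: "\<forall>\<^sub>F w in at z. dist w z < c"
    using c(1) by (auto simp: eventually_at)
  have "((\<lambda>w. norm (w - z) * (norm (resolvent A z f) / c)) \<longlongrightarrow> norm (z - z) * (norm (resolvent A z f) / c)) (at z)"
    by (intro tendsto_intros)
  then have lim: "((\<lambda>w. norm (w - z) * (norm (resolvent A z f) / c)) \<longlongrightarrow> 0) (at z)" by simp
  have "((\<lambda>w. resolvent A w f - resolvent A z f) \<longlongrightarrow> 0) (at z)"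
  proof (rule Lim_null_comparison[OF _ lim], rule eventually_mono[OF ev])
    fix w assume w: "dist w z < c"
    have "norm (resolvent A w (resolvent A z f)) \<le> norm (resolvent A z f) / c"
      using c(1) c(3)[OF w, of "resolvent A z f"] by (simp add: field_simps)
    then show "norm (resolvent A w f - resolvent A z f) \<le> norm (w - z) * (norm (resolvent A z f) / c)"
      by (subst resolvent_identity[OF sa_linear assms c(2)[OF w]])
        (simp add: norm_scaleC mult_left_mono del: times_divide_eq_right)
  qed
  then show ?thesis by (simp add: LIM_zero_iff)
qed

section \<open>The family of deficiency vectors and the Weyl--Titchmarsh function\<close>

text \<open>The operators (A - z)(A - w)^{-1} transport the deficiency vectors into each other; letting
  w tend to z gives the derivative, and w = i recovers g.\<close>

lemma deficiency_vector_shift: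
  assumes "z \<in> resolvent_set A" "w \<in> resolvent_set A"
  shows "deficiency_vector A g w
    = deficiency_vector A g z + (w - z) *\<^sub>C resolvent A w (deficiency_vector A g z)"
proof -
  define x where "x = resolvent A w (resolvent A z g)"
  have "resolvent A w (deficiency_vector A g z) = resolvent A w g + (z - \<i>) *\<^sub>C x"
    using assms by (simp add: deficiency_vector_def resolvent_add resolvent_scale sa_linear x_def)
  moreover have w: "resolvent A w g = resolvent A z g + (w - z) *\<^sub>C x"
    unfolding x_def by (rule resolvent_identity[OF sa_linear assms])
  ultimately have "resolvent A w (deficiency_vector A g z)
      = resolvent A z g + (w - z) *\<^sub>C x + (z - \<i>) *\<^sub>C x" by simp
  then show ?thesis
    by (simp only: deficiency_vector_def[of A g w] w)
      (simp add: deficiency_vector_def scaleC_simps algebra_simps)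
qed

lemma deficiency_vector_derivative:
  assumes "z \<in> resolvent_set A"
  shows "((\<lambda>w. inverse (w - z) *\<^sub>C (deficiency_vector A g w - deficiency_vector A g z))
    \<longlongrightarrow> resolvent A z (deficiency_vector A g z)) (at z)"
proof (rule Lim_transform_eventually[OF sa_resolvent_continuous[OF assms]])
  obtain c where c: "0 < c" "\<And>w. dist w z < c \<Longrightarrow> w \<in> resolvent_set A"
    using sa_resolvent_near[OF assms] by metis
  then have "\<forall>\<^sub>F w in at z. w \<noteq> z \<and> w \<in> resolvent_set A"
    by (auto simp: eventually_at)
  then show "\<forall>\<^sub>F w in at z. resolvent A w (deficiency_vector A g z)
      = inverse (w - z) *\<^sub>C (deficiency_vector A g w - deficiency_vector A g z)"
  proof (rule eventually_mono)
    fix w assume w: "w \<noteq> z \<and> w \<in> resolvent_set A"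
    then show "resolvent A w (deficiency_vector A g z)
      = inverse (w - z) *\<^sub>C (deficiency_vector A g w - deficiency_vector A g z)"
      by (subst deficiency_vector_shift[OF assms, of w]) (simp_all add: scaleC_scaleC scaleC_one)
  qed
qed

lemma deficiency_vector_continuous:
  assumes "z \<in> resolvent_set A"
  shows "(deficiency_vector A g \<longlongrightarrow> deficiency_vector A g z) (at z)"
proof -
  have "((\<lambda>w. g + (w - \<i>) *\<^sub>C resolvent A w g) \<longlongrightarrow> g + (z - \<i>) *\<^sub>C resolvent A z g) (at z)"
    by (intro tendsto_intros tendsto_scaleC sa_resolvent_continuous[OF assms])
  then show ?thesis unfolding deficiency_vector_def .
qed

text \<open>The reflected branch in the lower half-plane agrees with the direct formula because the adjoint
  of the resolvent at z is the resolvent at the conjugate of z.\<close>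

lemma weyl_titchmarsh_resolvent:
  assumes z: "z \<in> resolvent_set A" and "norm g = 1"
  shows "weyl_titchmarsh A g z = z + (1 + z\<^sup>2) * cinner (resolvent A z g) g"
proof -
  have raw: "cinner (w *\<^sub>C op_apply A (resolvent A w g) + resolvent A w g) g
      = w + (1 + w\<^sup>2) * cinner (resolvent A w g) g" if "w \<in> resolvent_set A" for w
  proof -
    have "single_valued A" using sa_linear by (simp add: linear_operator_def)
    then have "op_apply A (resolvent A w g) = g + w *\<^sub>C resolvent A w g"
      by (rule op_apply_eq[OF _ resolvent_in_graph[OF that]])
    then show ?thesis
      using cinner_self[of g] \<open>norm g = 1\<close>
      by (simp add: cinner_linear power2_eq_square algebra_simps)
  qed
  show ?thesis
  proof (cases "Im z < 0")
    case True
    have "cnj (cinner (resolvent A (cnj z) g) g) = cinner (resolvent A z g) g"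
      using sa_resolvent_adjoint[OF z, of g g] cinner_commute by metis
    with True show ?thesis
      using raw[OF sa_cnj_resolvent_set[OF z]] by (simp add: weyl_titchmarsh_def Let_def)
  qed (simp add: weyl_titchmarsh_def Let_def raw[OF z])
qed

lemma weyl_titchmarsh_deficiency_vector:
  assumes z: "z \<in> resolvent_set A" and g: "norm g = 1"
  shows "weyl_titchmarsh A g z + \<i> = (z + \<i>) * cinner (deficiency_vector A g z) g"
  using cinner_self[of g] g
  by (simp add: weyl_titchmarsh_resolvent[OF assms] deficiency_vector_def cinner_linear
      power2_eq_square algebra_simps)

text \<open>The Pick kernel of the Weyl--Titchmarsh function is the Gram kernel of the deficiency vectors.
  Symmetry of A enters through (z - cnj w) (u, v) = (u, g) - (g, v) for the resolvent vectors u and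
  v.\<close>

lemma weyl_titchmarsh_pick:
  assumes z: "z \<in> resolvent_set A" and w: "w \<in> resolvent_set A" and g: "norm g = 1"
  shows "(z - cnj w) * cinner (deficiency_vector A g z) (deficiency_vector A g w)
    = weyl_titchmarsh A g z - cnj (weyl_titchmarsh A g w)"
proof -
  define u v where "u = resolvent A z g" and "v = resolvent A w g"
  define \<alpha> \<beta> c where "\<alpha> = cinner u g" and "\<beta> = cinner g v" and "c = cinner u v"
  have "(u, g + z *\<^sub>C u) \<in> A" "(v, g + w *\<^sub>C v) \<in> A"
    using z w by (simp_all add: u_def v_def resolvent_in_graph)
  from sa_symmetric[OF this] have rel: "(z - cnj w) * c = \<alpha> - \<beta>"
    by (simp add: \<alpha>_def \<beta>_def c_def cinner_linear algebra_simps)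
  have "cinner (deficiency_vector A g z) (deficiency_vector A g w)
      = 1 + (z - \<i>) * \<alpha> + (cnj w + \<i>) * \<beta> + (z - \<i>) * (cnj w + \<i>) * c"
    using cinner_self[of g] g
    by (simp add: deficiency_vector_def flip: u_def v_def)
      (simp add: cinner_linear \<alpha>_def \<beta>_def c_def algebra_simps)
  then have "(z - cnj w) * cinner (deficiency_vector A g z) (deficiency_vector A g w)
      = (z - cnj w) * (1 + (z - \<i>) * \<alpha> + (cnj w + \<i>) * \<beta> + (z - \<i>) * (cnj w + \<i>) * c)"
    by (simp only:)
  also have "\<dots> = (z - cnj w) * (1 + (z - \<i>) * \<alpha> + (cnj w + \<i>) * \<beta>)
        + (z - \<i>) * (cnj w + \<i>) * ((z - cnj w) * c)"
    by (simp only: distrib_left mult.assoc mult.left_commute)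
  also have "\<dots> = (z + (1 + z\<^sup>2) * \<alpha>) - (cnj w + (1 + (cnj w)\<^sup>2) * \<beta>)"
    unfolding rel by (simp add: power2_eq_square algebra_simps)
  also have "\<beta> = cnj (cinner v g)"
    by (simp add: \<beta>_def flip: cinner_commute)
  finally show ?thesis
    unfolding weyl_titchmarsh_resolvent[OF z g] weyl_titchmarsh_resolvent[OF w g]
    by (simp add: u_def v_def \<alpha>_def)
qed

lemma weyl_titchmarsh_Im:
  assumes "z \<in> resolvent_set A" and "norm g = 1"
  shows "Im (weyl_titchmarsh A g z) = Im z * (norm (deficiency_vector A g z))\<^sup>2"
proof -
  have "(z - cnj z) * complex_of_real ((norm (deficiency_vector A g z))\<^sup>2)
      = weyl_titchmarsh A g z - cnj (weyl_titchmarsh A g z)"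
    using weyl_titchmarsh_pick[OF assms(1,1,2)] by (simp add: cinner_self)
  then have "Im ((z - cnj z) * complex_of_real ((norm (deficiency_vector A g z))\<^sup>2))
      = Im (weyl_titchmarsh A g z - cnj (weyl_titchmarsh A g z))"
    by simp
  then show ?thesis by simp
qed

lemma weyl_titchmarsh_cnj:
  assumes "z \<in> resolvent_set A" and "norm g = 1"
  shows "weyl_titchmarsh A g (cnj z) = cnj (weyl_titchmarsh A g z)"
  using weyl_titchmarsh_pick[OF sa_cnj_resolvent_set[OF assms(1)] assms] by simp

text \<open>With v n = n g(in), the imaginary parts of the Pick identity give
  |v n - v m|^2 = (m - n)/(m + n) (|v m|^2 - |v n|^2): a bounded sequence v n has increasing norms and
  is Cauchy. As (A - i)(g - g(in)) = (i - in) g(in) converges with v n while g(in) tends to 0, its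
  limit exhibits g in the domain.\<close>

lemma deficiency_vector_bounded_imp_domain:
  assumes g: "norm g = 1"
    and bound: "\<And>n. real (Suc n) * norm (deficiency_vector A g (\<i> * of_nat (Suc n))) \<le> K"
  shows "g \<in> Domain A"
proof -
  define y where "y n = real (Suc n)" for n
  define \<gamma> where "\<gamma> n = deficiency_vector A g (\<i> * complex_of_real (y n))" for n
  define v where "v n = complex_of_real (y n) *\<^sub>C \<gamma> n" for n
  have y: "0 < y n" for n by (simp add: y_def)
  have res: "\<i> * complex_of_real (y n) \<in> resolvent_set A" for n
    using y[of n] by (intro sa_nonreal_resolvent) simp
  have ires: "\<i> \<in> resolvent_set A" by (rule sa_nonreal_resolvent) simp
  have vK: "norm (v n) \<le> K" for n
    using bound[of n] y[of n] by (simp add: v_def norm_scaleC) (simp add: \<gamma>_def y_def)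
  have dist: "(y m + y n) * (norm (v n - v m))\<^sup>2 = (y m - y n) * ((norm (v m))\<^sup>2 - (norm (v n))\<^sup>2)" for m n
  proof -
    have "(\<i> * y n - cnj (\<i> * y m)) * cinner (\<gamma> n) (\<gamma> m)
        = weyl_titchmarsh A g (\<i> * y n) - cnj (weyl_titchmarsh A g (\<i> * y m))"
      unfolding \<gamma>_def by (rule weyl_titchmarsh_pick[OF res res g])
    then have "Im ((\<i> * y n - cnj (\<i> * y m)) * cinner (\<gamma> n) (\<gamma> m))
        = Im (weyl_titchmarsh A g (\<i> * y n)) + Im (weyl_titchmarsh A g (\<i> * y m))" by simp
    then have "(y n + y m) * Re (cinner (\<gamma> n) (\<gamma> m)) = y n * (norm (\<gamma> n))\<^sup>2 + y m * (norm (\<gamma> m))\<^sup>2"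
      unfolding weyl_titchmarsh_Im[OF res g] \<gamma>_def[symmetric] by (simp add: algebra_simps)
    then have "y n * y m * ((y n + y m) * Re (cinner (\<gamma> n) (\<gamma> m)))
        = y n * y m * (y n * (norm (\<gamma> n))\<^sup>2 + y m * (norm (\<gamma> m))\<^sup>2)" by simp
    then have "(y n + y m) * inner (v n) (v m) = y m * (norm (v n))\<^sup>2 + y n * (norm (v m))\<^sup>2"
      using y[of n] y[of m]
      by (simp add: v_def inner_Re_cinner cinner_linear norm_scaleC power_mult_distrib
          power2_eq_square algebra_simps)
    then show ?thesis
      using dot_norm_neg[of "v n" "v m"] by (simp add: algebra_simps)
  qed
  have "Cauchy v"
  proof -
    define q where "q n = (norm (v n))\<^sup>2" for n
    have inc: "q n \<le> q m" if "n \<le> m" for n m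
    proof (cases "n = m")
      case False
      with that have "0 < y m - y n" by (simp add: y_def)
      moreover have "0 \<le> (y m - y n) * (q m - q n)"
        using dist[of m n] y[of n] y[of m]
        by (metis q_def add_pos_pos less_imp_le mult_nonneg_nonneg zero_le_power2)
      ultimately show ?thesis by (simp add: zero_le_mult_iff)
    qed simp
    have "q n \<le> K\<^sup>2" for n unfolding q_def using vK by (simp add: power_mono)
    then have "convergent q"
      using inc by (intro Bseq_monoseq_convergent BseqI'[of _ "K\<^sup>2"]) (auto simp: q_def monoseq_def)
    then have "Cauchy q" by (simp add: convergent_Cauchy)
    have est: "(norm (v n - v m))\<^sup>2 \<le> \<bar>q m - q n\<bar>" for m n
    proof -
      have "(y m + y n) * (norm (v n - v m))\<^sup>2 \<le> \<bar>y m - y n\<bar> * \<bar>q m - q n\<bar>"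
        using dist[of m n] by (simp add: q_def flip: abs_mult)
      also have "\<dots> \<le> (y m + y n) * \<bar>q m - q n\<bar>"
        using y[of n] y[of m] by (intro mult_right_mono) auto
      finally show ?thesis using y[of n] y[of m] by simp
    qed
    show ?thesis
    proof (rule CauchyI)
      fix e :: real assume "0 < e"
      then obtain N where N: "\<And>m n. N \<le> m \<Longrightarrow> N \<le> n \<Longrightarrow> norm (q m - q n) < e\<^sup>2"
        using CauchyD[OF \<open>Cauchy q\<close>, of "e\<^sup>2"] by auto
      have "norm (v m - v n) < e" if "N \<le> m" "N \<le> n" for m n
        by (rule power2_less_imp_less[of _ e])
          (use est[of m n] N[OF that(2,1)] \<open>0 < e\<close> in auto)
      then show "\<exists>N. \<forall>m\<ge>N. \<forall>n\<ge>N. norm (v m - v n) < e" by blast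
    qed
  qed
  then obtain h where h: "v \<longlonglongrightarrow> h" using Cauchy_convergent convergent_def by blast
  have inv: "(\<lambda>n. complex_of_real (inverse (y n))) \<longlonglongrightarrow> complex_of_real 0"
    unfolding y_def by (intro tendsto_of_real LIMSEQ_inverse_real_of_nat)
  have \<gamma>_eq: "\<gamma> n = complex_of_real (inverse (y n)) *\<^sub>C v n" for n
    using y[of n] by (simp add: v_def scaleC_simps flip: of_real_mult)
  have \<gamma>_lim: "\<gamma> \<longlonglongrightarrow> 0"
    using tendsto_scaleC[OF inv h] unfolding \<gamma>_eq by simp
  have "resolvent A \<i> ((\<i> - \<i> * complex_of_real (y n)) *\<^sub>C \<gamma> n) = g - \<gamma> n" for n
  proof -
    have g1: "deficiency_vector A g \<i> = g" by (simp add: deficiency_vector_def)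
    have "g = \<gamma> n + (\<i> - \<i> * complex_of_real (y n)) *\<^sub>C resolvent A \<i> (\<gamma> n)"
      using deficiency_vector_shift[OF res ires, of g n] unfolding g1 \<gamma>_def .
    then show ?thesis
      by (subst resolvent_scale[OF sa_linear ires]) (metis add_diff_cancel_left')
  qed
  moreover have "(\<i> - \<i> * complex_of_real (y n)) *\<^sub>C \<gamma> n = \<i> *\<^sub>C \<gamma> n - \<i> *\<^sub>C v n" for n
    by (simp add: v_def scaleC_simps)
  ultimately have eq: "resolvent A \<i> (\<i> *\<^sub>C \<gamma> n - \<i> *\<^sub>C v n) = g - \<gamma> n" for n by metis
  have "(\<lambda>n. resolvent A \<i> (\<i> *\<^sub>C \<gamma> n - \<i> *\<^sub>C v n)) \<longlonglongrightarrow> resolvent A \<i> (\<i> *\<^sub>C 0 - \<i> *\<^sub>C h)"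
    by (intro bounded_linear.tendsto[OF resolvent_set_resolvent(1)[OF ires]]
        tendsto_diff tendsto_scaleC h \<gamma>_lim tendsto_const)
  moreover have "(\<lambda>n. g - \<gamma> n) \<longlonglongrightarrow> g - 0"
    by (intro tendsto_intros \<gamma>_lim)
  ultimately have "g = resolvent A \<i> (\<i> *\<^sub>C 0 - \<i> *\<^sub>C h)"
    unfolding eq using LIMSEQ_unique by fastforce
  then show ?thesis using resolvent_in_graph[OF ires] by (metis DomainI)
qed

end

section \<open>The trigonometric moment problem for an isometry\<close>

lemma integral_cis_period:
  fixes k :: int
  shows "has_bochner_integral lborel (\<lambda>\<theta>. indicator {-pi..pi} \<theta> *\<^sub>R cis (of_int k * \<theta>))
    (if k = 0 then 2 * of_real pi else 0)"
proof (cases "k = 0")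
  case True
  have "has_bochner_integral lborel (\<lambda>\<theta>::real. indicator {-pi..pi} \<theta> *\<^sub>R (1::complex))
      (of_real pi - of_real (-pi))"
    by (rule has_bochner_integral_FTC_Icc)
      (auto intro!: derivative_eq_intros simp: has_vector_derivative_def scaleR_conv_of_real)
  with True show ?thesis by simp
next
  case False
  define F where "F \<theta> = cis (of_int k * \<theta>) / (\<i> * of_int k)" for \<theta>
  have "has_bochner_integral lborel (\<lambda>\<theta>. indicator {-pi..pi} \<theta> *\<^sub>R cis (of_int k * \<theta>)) (F pi - F (-pi))"
  proof (rule has_bochner_integral_FTC_Icc)
    show "(F has_vector_derivative cis (of_int k * \<theta>)) (at \<theta> within {-pi..pi})" for \<theta>
      unfolding F_def cis_conv_exp using False
      by (auto intro!: derivative_eq_intros has_vector_derivative_real_field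
          simp: field_simps)
  qed (auto intro!: continuous_intros)
  moreover have "sin (of_int k * pi) = 0" by (metis sin_zero_iff_int2)
  then have "cis (of_int k * pi) = cis (of_int k * - pi)" by (simp add: complex_eq_iff)
  then have "F pi - F (-pi) = 0" by (simp only: F_def diff_self)
  ultimately show ?thesis using False by simp
qed

context
  fixes V :: "'a::complex_hilbert_space \<Rightarrow> 'a"
  assumes V_add: "V (x + y) = V x + V y"
    and V_scale: "V (a *\<^sub>C x) = a *\<^sub>C V x"
    and V_iso: "cinner (V x) (V y) = cinner x y"
begin

lemma V_pow_iso: "cinner ((V ^^ n) x) ((V ^^ n) y) = cinner x y"
  by (induction n) (simp_all add: V_iso)

lemma V_pow_norm: "norm ((V ^^ n) x) = norm x"
proof -
  have "complex_of_real ((norm ((V ^^ n) x))\<^sup>2) = complex_of_real ((norm x)\<^sup>2)"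
    unfolding cinner_self[symmetric] by (rule V_pow_iso)
  then show ?thesis unfolding of_real_eq_iff by (simp add: power2_eq_iff_nonneg)
qed

lemma V_pow_add: "(V ^^ n) (x + y) = (V ^^ n) x + (V ^^ n) y"
  by (induction n) (simp_all add: V_add)

lemma V_pow_scale: "(V ^^ n) (a *\<^sub>C x) = a *\<^sub>C (V ^^ n) x"
  by (induction n) (simp_all add: V_scale)

lemma V_pow_diff: "(V ^^ n) (x - y) = (V ^^ n) x - (V ^^ n) y"
  using V_pow_add[of n "x - y" y] by simp

text \<open>Expanding the squared norm gives, up to the factor 1/(2 pi), the Fejer mean of the Fourier
  series with coefficients (V^n g, g); written as a squared norm it is visibly nonnegative.\<close>

definition fejer_density :: "'a \<Rightarrow> nat \<Rightarrow> real \<Rightarrow> real" where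
  "fejer_density g N \<theta> =
     (norm (\<Sum>j<N. cis (- (real j * \<theta>)) *\<^sub>C (V ^^ j) g))\<^sup>2 / (2 * pi * real N)"

lemma fejer_density_expand:
  "complex_of_real (fejer_density g N \<theta>)
    = (\<Sum>j<N. \<Sum>k<N. cinner ((V ^^ j) g) ((V ^^ k) g) * cis (of_int (int k - int j) * \<theta>)) / (2 * pi * real N)"
proof -
  have "complex_of_real ((norm (\<Sum>j<N. cis (- (real j * \<theta>)) *\<^sub>C (V ^^ j) g))\<^sup>2)
    = (\<Sum>j<N. \<Sum>k<N. cinner ((V ^^ j) g) ((V ^^ k) g) * cis (of_int (int k - int j) * \<theta>))"
    unfolding cinner_self[symmetric] cinner_sum_left cinner_sum_right cinner_scaleC_left
      cinner_scaleC_right sum_distrib_left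
    by (subst sum.swap, intro sum.cong refl)
      (simp add: cis_cnj cis_mult left_diff_distrib flip: mult.assoc)
  then show ?thesis by (simp add: fejer_density_def)
qed

text \<open>Integration over the period keeps the pairs with j = n + k. There are N - n of them, and as V
  is isometric each contributes the same inner product.\<close>

lemma fejer_density_moment:
  assumes "0 < N"
  shows "has_bochner_integral lborel
    (\<lambda>\<theta>. (indicator {-pi..pi} \<theta> * fejer_density g N \<theta>) *\<^sub>R cis (real n * \<theta>))
    (of_real (real (N - n) / real N) * cinner ((V ^^ n) g) g)"
proof -
  define b where "b j k = cinner ((V ^^ j) g) ((V ^^ k) g) / complex_of_real (2 * pi * real N)" for j k
  have "has_bochner_integral lborel
      (\<lambda>\<theta>. \<Sum>j<N. \<Sum>k<N. b j k * (indicator {-pi..pi} \<theta> *\<^sub>R cis (of_int (int n + int k - int j) * \<theta>)))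
      (\<Sum>j<N. \<Sum>k<N. b j k * (if int n + int k - int j = 0 then 2 * of_real pi else 0))"
    by (intro has_bochner_integral_sum has_bochner_integral_mult_right integral_cis_period)
  moreover have "(\<Sum>j<N. \<Sum>k<N. b j k * (indicator {-pi..pi} \<theta> *\<^sub>R cis (of_int (int n + int k - int j) * \<theta>)))
      = (indicator {-pi..pi} \<theta> * fejer_density g N \<theta>) *\<^sub>R cis (real n * \<theta>)" for \<theta> :: real
    unfolding scaleR_conv_of_real of_real_mult fejer_density_expand sum_divide_distrib
      sum_distrib_left sum_distrib_right
    by (intro sum.cong refl) (simp add: b_def cis_mult algebra_simps)
  moreover have "(\<Sum>j<N. \<Sum>k<N. b j k * (if int n + int k - int j = 0 then 2 * of_real pi else 0))
      = of_real (real (N - n) / real N) * cinner ((V ^^ n) g) g"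
  proof -
    have "(\<Sum>j<N. \<Sum>k<N. b j k * (if int n + int k - int j = 0 then 2 * of_real pi else 0))
        = (\<Sum>k<N. \<Sum>j<N. if j = n + k then b j k * (2 * of_real pi) else 0)"
      by (subst sum.swap) (intro sum.cong refl, auto)
    also have "\<dots> = (\<Sum>k<N. if n + k < N then b (n + k) k * (2 * of_real pi) else 0)"
      by (simp add: sum.delta)
    also have "\<dots> = (\<Sum>k<N. if n + k < N then cinner ((V ^^ n) g) g / of_nat N else 0)"
    proof (intro sum.cong refl)
      fix k
      have "cinner ((V ^^ (n + k)) g) ((V ^^ k) g) = cinner ((V ^^ n) g) g"
        using V_pow_iso[of k "(V ^^ n) g" g] by (simp add: add.commute[of n] funpow_add)
      then show "(if n + k < N then b (n + k) k * (2 * of_real pi) else 0)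
          = (if n + k < N then cinner ((V ^^ n) g) g / of_nat N else 0)"
        by (simp add: b_def)
    qed
    also have "\<dots> = (\<Sum>k\<in>{k\<in>{..<N}. n + k < N}. cinner ((V ^^ n) g) g / of_nat N)"
      by (rule sum.inter_filter[symmetric]) simp
    also have "{k\<in>{..<N}. n + k < N} = {..<N - n}" by auto
    finally show ?thesis by simp
  qed
  ultimately show ?thesis by simp
qed

text \<open>The Fejer densities live on one fixed interval, so by Helly they have a weak limit
  point; the factors (N - n)/N in their moments tend to 1.\<close>

lemma trigonometric_moments:
  assumes g: "norm g = 1"
  obtains m :: "real measure" where "real_distribution m"
    "\<And>n. (LINT \<theta>|m. cis (real n * \<theta>)) = cinner ((V ^^ n) g) g"
proof -
  define f where "f N \<theta> = indicator {-pi..pi} \<theta> * fejer_density g (Suc N) \<theta>" for N and \<theta> :: real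
  define M where "M N = density lborel (\<lambda>\<theta>. ennreal (f N \<theta>))" for N
  have f0: "0 \<le> f N \<theta>" for N \<theta>
    by (simp add: f_def fejer_density_def)
  have [measurable]: "(\<lambda>\<theta>. cis (real j * \<theta>)) \<in> borel_measurable borel" for j
    by (intro borel_measurable_continuous_onI continuous_intros)
  have mf [measurable]: "f N \<in> borel_measurable borel" for N
  proof -
    have "fejer_density g (Suc N) \<in> borel_measurable borel"
      unfolding fejer_density_def
      by (intro borel_measurable_continuous_onI continuous_intros
          bounded_bilinear.continuous_on[OF bounded_bilinear_scaleC]) auto
    then show ?thesis unfolding f_def by measurable
  qed
  have moment: "(LINT \<theta>|M N. cis (real n * \<theta>))
      = of_real (real (Suc N - n) / real (Suc N)) * cinner ((V ^^ n) g) g" for N n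
    unfolding M_def
    by (subst integral_density)
      (use has_bochner_integral_integral_eq[OF fejer_density_moment[of "Suc N" g n]] f0 in
        \<open>simp_all add: f_def\<close>)
  have mass: "emeasure (M N) {-pi..pi} = 1" "emeasure (M N) UNIV = 1" for N
  proof -
    have "has_bochner_integral lborel (\<lambda>\<theta>. complex_of_real (f N \<theta>)) 1"
      using fejer_density_moment[of "Suc N" g 0] cinner_self[of g] g
      by (simp add: f_def scaleR_conv_of_real)
    then have "has_bochner_integral lborel (\<lambda>\<theta>. Re (complex_of_real (f N \<theta>))) (Re 1)"
      by (rule has_bochner_integral_bounded_linear[OF bounded_linear_Re])
    then have "has_bochner_integral lborel (f N) 1" by simp
    then have 1: "(\<integral>\<^sup>+\<theta>. ennreal (f N \<theta>) \<partial>lborel) = 1"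
      using nn_integral_eq_integral[of lborel "f N"] f0
      by (simp add: has_bochner_integral_iff)
    then show "emeasure (M N) UNIV = 1"
      by (simp add: M_def emeasure_density)
    have "ennreal (f N \<theta>) * indicator {-pi..pi} \<theta> = ennreal (f N \<theta>)" for \<theta>
      by (simp add: f_def indicator_def)
    then show "emeasure (M N) {-pi..pi} = 1"
      using 1 by (simp add: M_def emeasure_density)
  qed
  have rd: "real_distribution (M N)" for N
  proof -
    have "prob_space (M N)"
      using mass(2)[of N] by (intro prob_spaceI) (simp add: M_def)
    then show ?thesis
      by (simp add: real_distribution_def real_distribution_axioms_def M_def)
  qed
  have "1 - e < measure (M N) {-4<..4}" if "0 < e" for e :: real and N
  proof -
    interpret real_distribution "M N" by (rule rd)
    have "1 = measure (M N) {-pi..pi}"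
      using mass(1)[of N] by (simp add: measure_def)
    also have "\<dots> \<le> measure (M N) {-4<..4}"
      using pi_less_4 by (intro finite_measure_mono) auto
    finally show ?thesis using that by simp
  qed
  then have "\<exists>a b. a < b \<and> (\<forall>N. 1 - e < measure (M N) {a<..b})" if "0 < e" for e :: real
    using that by (intro exI[of _ "-4"] exI[of _ 4]) simp
  with rd have "tight M" unfolding tight_def by blast
  from tight_imp_convergent_subsubsequence[OF this, of id]
  obtain r m where r: "strict_mono (r :: nat \<Rightarrow> nat)" and m: "real_distribution m"
    and conv: "weak_conv_m (M \<circ> r) m"
    by (auto simp: strict_mono_def)
  have "(LINT \<theta>|m. cis (real n * \<theta>)) = cinner ((V ^^ n) g) g" for n
  proof (rule LIMSEQ_unique)
    have "continuous_on UNIV (\<lambda>\<theta>. cis (real n * \<theta>))" by (intro continuous_intros)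
    then have cont: "isCont (\<lambda>\<theta>. cis (real n * \<theta>)) \<theta>" for \<theta>
      by (simp add: continuous_on_eq_continuous_at)
    show "(\<lambda>N. LINT \<theta>|(M \<circ> r) N. cis (real n * \<theta>)) \<longlonglongrightarrow> (LINT \<theta>|m. cis (real n * \<theta>))"
      by (rule weak_conv_imp_integral_bdd_continuous_conv[OF _ m conv, where B = 1])
        (auto simp: rd cont)
    have "(\<lambda>N. real (Suc N - n) / real (Suc N)) \<longlonglongrightarrow> 1"
    proof (rule Lim_transform_eventually)
      show "(\<lambda>N. 1 - real n * (1 / real (Suc N))) \<longlonglongrightarrow> 1"
        using tendsto_diff[OF tendsto_const tendsto_mult[OF tendsto_const LIMSEQ_Suc[OF lim_const_over_n[of 1]]],
          of 1 "real n"] by simp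
      show "\<forall>\<^sub>F N in sequentially. 1 - real n * (1 / real (Suc N)) = real (Suc N - n) / real (Suc N)"
        using eventually_ge_at_top[of n] by eventually_elim (simp add: field_simps of_nat_diff)
    qed
    from tendsto_mult[OF tendsto_of_real[OF this] tendsto_const, of "cinner ((V ^^ n) g) g"]
    have "(\<lambda>N. LINT \<theta>|M N. cis (real n * \<theta>)) \<longlonglongrightarrow> cinner ((V ^^ n) g) g"
      unfolding moment by simp
    from LIMSEQ_subseq_LIMSEQ[OF this r]
    show "(\<lambda>N. LINT \<theta>|(M \<circ> r) N. cis (real n * \<theta>)) \<longlonglongrightarrow> cinner ((V ^^ n) g) g"
      by (simp add: comp_def)
  qed
  with m that show ?thesis by blast
qed

context
  fixes m :: "real measure" and g :: 'a
  assumes m: "real_distribution m"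
    and moments: "(LINT \<theta>|m. cis (real n * \<theta>)) = cinner ((V ^^ n) g) g"
begin

interpretation real_distribution m by (rule m)

lemma integrable_bounded_continuous:
  fixes h :: "real \<Rightarrow> complex"
  assumes "continuous_on UNIV h" "\<And>\<theta>. norm (h \<theta>) \<le> B"
  shows "integrable m h"
  by (rule integrable_const_bound[of _ B])
    (use assms in \<open>auto simp: measurable_cong_sets[OF events_eq_borel refl]
      intro!: borel_measurable_continuous_onI\<close>)

lemma integral_cis_power_sum:
  "(LINT \<theta>|m. (\<Sum>k<N. a k * cis (real k * \<theta>))) = (\<Sum>k<N. a k * cinner ((V ^^ k) g) g)"
  by (subst Bochner_Integration.integral_sum)
    (auto simp: moments intro!: integrable_mult_right integrable_bounded_continuous[where B = 1]
      continuous_intros)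

text \<open>The averages of the functions cis (k \<theta>) tend to the indicator of cis \<theta> = 1, while the averages
  of V^k g tend to 0 on the closure of the range of V - 1 by telescoping: this is the mean ergodic
  theorem, read through the moments.\<close>

lemma no_atom_at_1:
  assumes dense: "g \<in> closure (range (\<lambda>y. V y - y))"
  shows "AE \<theta> in m. cis \<theta> \<noteq> 1"
proof -
  define a where "a N \<theta> = (\<Sum>k<N. complex_of_real (1 / real N) * cis (real k * \<theta>))" for N \<theta>
  have bound: "norm (a N \<theta>) \<le> 1" for N \<theta>
  proof -
    have "norm (a N \<theta>) \<le> (\<Sum>k<N. 1 / real N)"
      unfolding a_def by (rule sum_norm_le) (simp add: norm_mult norm_divide)
    also have "\<dots> \<le> 1" by simp
    finally show ?thesis .
  qed
  have lim: "(\<lambda>N. a N \<theta>) \<longlonglongrightarrow> indicator {\<theta>. cis \<theta> = 1} \<theta>" for \<theta>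
  proof (cases "cis \<theta> = 1")
    case True
    then have "a N \<theta> = (if N = 0 then 0 else 1)" for N
      by (simp add: a_def flip: Complex.DeMoivre)
    then have "\<forall>\<^sub>F N in sequentially. indicator {\<theta>. cis \<theta> = 1} \<theta> = a N \<theta>"
      using True eventually_gt_at_top[of 0] by (auto elim!: eventually_mono)
    then show ?thesis by (rule Lim_transform_eventually[OF tendsto_const])
  next
    case False
    have a: "a N \<theta> = complex_of_real (1 / real N) * ((cis \<theta> ^ N - 1) / (cis \<theta> - 1))" for N
      using geometric_sum[OF False, of N]
      unfolding a_def Complex.DeMoivre[symmetric] sum_distrib_left[symmetric] by simp
    have "norm (a N \<theta>) \<le> 1 / real N * (2 / norm (cis \<theta> - 1))" for N
    proof -
      have "norm (cis \<theta> ^ N - 1) \<le> 2"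
        using norm_triangle_ineq4[of "cis \<theta> ^ N" 1] by (simp add: norm_power)
      then show ?thesis
        unfolding a norm_mult norm_divide
        by (intro mult_mono divide_right_mono) (auto simp: norm_divide)
    qed
    moreover have "(\<lambda>N. 1 / real N * (2 / norm (cis \<theta> - 1))) \<longlonglongrightarrow> 0 * (2 / norm (cis \<theta> - 1))"
      by (intro tendsto_intros lim_const_over_n)
    ultimately have "(\<lambda>N. a N \<theta>) \<longlonglongrightarrow> 0"
      by (intro Lim_null_comparison[of "\<lambda>N. a N \<theta>" "\<lambda>N. 1 / real N * (2 / norm (cis \<theta> - 1))"]) auto
    with False show ?thesis by simp
  qed
  have [measurable]: "{\<theta>. cis \<theta> = 1} \<in> sets borel"
    by (intro borel_closed closed_Collect_eq continuous_intros)
  have "(\<lambda>N. LINT \<theta>|m. a N \<theta>) \<longlonglongrightarrow> (LINT \<theta>|m. indicator {\<theta>. cis \<theta> = 1} \<theta>)"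
  proof (rule integral_dominated_convergence[where w = "\<lambda>_. 1"])
    show "a N \<in> borel_measurable m" for N
      unfolding a_def
      by (auto simp: measurable_cong_sets[OF events_eq_borel refl]
          intro!: borel_measurable_continuous_onI continuous_intros)
  qed (use lim bound in auto)
  moreover have "(\<lambda>N. LINT \<theta>|m. a N \<theta>) \<longlonglongrightarrow> 0"
  proof -
    define T where "T N x = (\<Sum>k<N. complex_of_real (1 / real N) *\<^sub>C (V ^^ k) x)" for N x
    have T_add: "T N (x + y) = T N x + T N y" for N x y
      by (simp add: T_def V_pow_add scaleC_simps sum.distrib)
    have T_norm: "norm (T N x) \<le> norm x" for N x
    proof -
      have "norm (T N x) \<le> (\<Sum>k<N. 1 / real N * norm x)"
        unfolding T_def by (rule sum_norm_le) (simp add: norm_scaleC V_pow_norm norm_divide)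
      also have "\<dots> \<le> norm x" by simp
      finally show ?thesis .
    qed
    have T_range: "norm (T N (V y - y)) \<le> 1 / real N * (2 * norm y)" for N y
    proof -
      have "T N (V y - y) = complex_of_real (1 / real N) *\<^sub>C (\<Sum>k<N. (V ^^ Suc k) y - (V ^^ k) y)"
        unfolding T_def complex_vector.scale_sum_right
        by (simp add: V_pow_diff funpow_swap1)
      also have "(\<Sum>k<N. (V ^^ Suc k) y - (V ^^ k) y) = (V ^^ N) y - y"
        by (subst sum_lessThan_telescope) simp
      finally have "norm (T N (V y - y)) = 1 / real N * norm ((V ^^ N) y - y)"
        by (simp add: norm_scaleC norm_divide)
      also have "norm ((V ^^ N) y - y) \<le> 2 * norm y"
        using norm_triangle_ineq4[of "(V ^^ N) y" y] by (simp add: V_pow_norm)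
      finally show ?thesis by (simp add: mult_left_mono divide_right_mono)
    qed
    have "(\<lambda>N. T N g) \<longlonglongrightarrow> 0"
    proof (rule LIMSEQ_I)
      fix e :: real assume "0 < e"
      then obtain y where y: "dist (V y - y) g < e / 2"
        using dense unfolding closure_approachable by (auto dest!: spec[of _ "e / 2"])
      have "(\<lambda>N. 1 / real N * (2 * norm y)) \<longlonglongrightarrow> 0 * (2 * norm y)"
        by (intro tendsto_intros lim_const_over_n)
      then have "\<forall>\<^sub>F N in sequentially. 1 / real N * (2 * norm y) < e / 2"
        using \<open>0 < e\<close> by (intro order_tendstoD(2)) auto
      then obtain N0 where N0: "\<And>N. N0 \<le> N \<Longrightarrow> 1 / real N * (2 * norm y) < e / 2"
        by (auto simp: eventually_sequentially)
      have "norm (T N g - 0) < e" if "N0 \<le> N" for N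
      proof -
        have "T N g = T N (V y - y) + T N (g - (V y - y))"
          unfolding T_add[symmetric] by simp
        then have "norm (T N g) \<le> norm (T N (V y - y)) + norm (T N (g - (V y - y)))"
          by (metis norm_triangle_ineq)
        also have "\<dots> < e / 2 + e / 2"
          using T_range[of N y] N0[OF that] T_norm[of N "g - (V y - y)"] y
          by (intro add_strict_mono) (auto simp: dist_norm norm_minus_commute)
        finally show ?thesis by simp
      qed
      then show "\<exists>N0. \<forall>N\<ge>N0. norm (T N g - 0) < e" by blast
    qed
    then have "(\<lambda>N. cinner (T N g) g) \<longlonglongrightarrow> cinner 0 g"
      by (intro tendsto_cinner tendsto_const)
    moreover have "(LINT \<theta>|m. a N \<theta>) = cinner (T N g) g" for N
      unfolding a_def integral_cis_power_sum T_def by (simp add: cinner_sum_left cinner_scaleC_left)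
    ultimately show ?thesis by simp
  qed
  ultimately have "(LINT \<theta>|m. indicator {\<theta>. cis \<theta> = 1} \<theta>) = (0::complex)"
    using LIMSEQ_unique by blast
  then have "(LINT \<theta>|m. complex_of_real (indicator {\<theta>. cis \<theta> = 1} \<theta>)) = 0"
    by (simp add: of_real_indicator)
  then have "measure m {\<theta>. cis \<theta> = 1} = 0"
    by (simp add: measurable_cong_sets)
  then have "{\<theta>. cis \<theta> = 1} \<in> null_sets m"
    by (auto simp: null_sets_def emeasure_eq_measure)
  from AE_not_in[OF this] show ?thesis by simp
qed

text \<open>Iterating x = g + \<zeta> V x gives finite sections of the Neumann series with a remainder that tends to
  0, so the series need not be summed in the Hilbert space.\<close>

lemma resolvent_moment:
  assumes \<zeta>: "cmod \<zeta> < 1" and x: "x - \<zeta> *\<^sub>C V x = g"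
  shows "cinner x g = (LINT \<theta>|m. 1 / (1 - \<zeta> * cis \<theta>))"
proof (rule LIMSEQ_unique)
  define q where "q N \<theta> = (\<Sum>k<N. \<zeta> ^ k * cis (real k * \<theta>))" for N \<theta>
  have q: "q N \<theta> = (\<Sum>k<N. (\<zeta> * cis \<theta>) ^ k)" for N \<theta>
    by (simp only: q_def power_mult_distrib Complex.DeMoivre)
  have small: "cmod (\<zeta> * cis \<theta>) < 1" for \<theta> using \<zeta> by (simp add: norm_mult)
  show "(\<lambda>N. LINT \<theta>|m. q N \<theta>) \<longlonglongrightarrow> (LINT \<theta>|m. 1 / (1 - \<zeta> * cis \<theta>))"
  proof (rule integral_dominated_convergence[where w = "\<lambda>_. 1 / (1 - cmod \<zeta>)"])
    show "AE \<theta> in m. (\<lambda>N. q N \<theta>) \<longlonglongrightarrow> 1 / (1 - \<zeta> * cis \<theta>)"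
      using geometric_sums[OF small] by (simp add: q sums_def)
    show "AE \<theta> in m. norm (q N \<theta>) \<le> 1 / (1 - cmod \<zeta>)" for N
    proof (rule AE_I2)
      fix \<theta>
      have "norm (q N \<theta>) \<le> (\<Sum>k<N. cmod \<zeta> ^ k)"
        unfolding q by (rule sum_norm_le) (simp add: norm_power norm_mult)
      also have "\<dots> \<le> (\<Sum>k. cmod \<zeta> ^ k)"
        using \<zeta> by (intro sum_le_suminf summable_geometric) auto
      also have "\<dots> = 1 / (1 - cmod \<zeta>)"
        using \<zeta> by (simp add: suminf_geometric)
      finally show "norm (q N \<theta>) \<le> 1 / (1 - cmod \<zeta>)" .
    qed
    have nz: "1 - \<zeta> * cis \<theta> \<noteq> 0" for \<theta> using small[of \<theta>] by auto
    show "(\<lambda>\<theta>. 1 / (1 - \<zeta> * cis \<theta>)) \<in> borel_measurable m"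
      using nz by (auto simp: measurable_cong_sets[OF events_eq_borel refl]
          intro!: borel_measurable_continuous_onI continuous_intros)
    show "q N \<in> borel_measurable m" for N
      unfolding q_def by (auto simp: measurable_cong_sets[OF events_eq_borel refl]
          intro!: borel_measurable_continuous_onI continuous_intros)
  qed simp
  have iter: "x = (\<Sum>k<N. \<zeta> ^ k *\<^sub>C (V ^^ k) g) + \<zeta> ^ N *\<^sub>C (V ^^ N) x" for N
  proof (induction N)
    case (Suc N)
    have "x = g + \<zeta> *\<^sub>C V x" using x by (simp add: algebra_simps)
    then have "(V ^^ N) x = (V ^^ N) g + \<zeta> *\<^sub>C (V ^^ Suc N) x"
      by (metis V_pow_add V_pow_scale funpow_Suc_right comp_apply)
    then have step: "\<zeta> ^ N *\<^sub>C (V ^^ N) x = \<zeta> ^ N *\<^sub>C (V ^^ N) g + \<zeta> ^ Suc N *\<^sub>C (V ^^ Suc N) x"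
      by (simp only: scaleC_add_right scaleC_scaleC power_Suc2)
    note Suc.IH
    also have "(\<Sum>k<N. \<zeta> ^ k *\<^sub>C (V ^^ k) g) + \<zeta> ^ N *\<^sub>C (V ^^ N) x
        = (\<Sum>k<Suc N. \<zeta> ^ k *\<^sub>C (V ^^ k) g) + \<zeta> ^ Suc N *\<^sub>C (V ^^ Suc N) x"
      by (simp only: step sum.lessThan_Suc add.assoc)
    finally show ?case .
  qed (simp add: scaleC_one)
  have qN: "(LINT \<theta>|m. q N \<theta>) = cinner x g - \<zeta> ^ N * cinner ((V ^^ N) x) g" for N
  proof -
    have "cinner x g = (\<Sum>k<N. \<zeta> ^ k * cinner ((V ^^ k) g) g) + \<zeta> ^ N * cinner ((V ^^ N) x) g"
      by (subst iter[of N]) (simp add: cinner_linear cinner_sum_left)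
    then show ?thesis unfolding q_def integral_cis_power_sum by simp
  qed
  have "(\<lambda>N. \<zeta> ^ N * cinner ((V ^^ N) x) g) \<longlonglongrightarrow> 0"
  proof (rule Lim_null_comparison)
    show "\<forall>\<^sub>F N in sequentially. norm (\<zeta> ^ N * cinner ((V ^^ N) x) g) \<le> cmod \<zeta> ^ N * (norm x * norm g)"
    proof (rule always_eventually, rule allI)
      fix N
      show "norm (\<zeta> ^ N * cinner ((V ^^ N) x) g) \<le> cmod \<zeta> ^ N * (norm x * norm g)"
        using cinner_norm_le[of "(V ^^ N) x" g]
        by (simp add: norm_mult norm_power V_pow_norm mult_left_mono)
    qed
    have "(\<lambda>N. cmod \<zeta> ^ N * (norm x * norm g)) \<longlonglongrightarrow> 0 * (norm x * norm g)"
      using \<zeta> by (intro tendsto_intros LIMSEQ_realpow_zero) auto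
    then show "(\<lambda>N. cmod \<zeta> ^ N * (norm x * norm g)) \<longlonglongrightarrow> 0" by simp
  qed
  from tendsto_diff[OF tendsto_const this, of "cinner x g"]
  show "(\<lambda>N. LINT \<theta>|m. q N \<theta>) \<longlonglongrightarrow> cinner x g"
    unfolding qN by simp
qed

end

end

section \<open>The measure of the Weyl--Titchmarsh function\<close>

text \<open>This is (A + i)(A - i)^{-1}.\<close>

definition cayley :: "'a::complex_hilbert_space opgraph \<Rightarrow> 'a \<Rightarrow> 'a" where
  "cayley A x = x + (2 * \<i>) *\<^sub>C resolvent A \<i> x"

text \<open>Both sides equal (1 + t z)/(t - z). The left side is the Herglotz--Nevanlinna kernel against
  (1 + t^2) d\<nu>; the right side shows that it is a bounded function against d\<nu> when z is not real.\<close>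

lemma nevanlinna_kernel:
  assumes "complex_of_real t \<noteq> z"
  shows "(1 + t\<^sup>2) *\<^sub>R (1 / (of_real t - z) - of_real (t / (1 + t\<^sup>2))) = z + (1 + z\<^sup>2) / (of_real t - z)"
proof -
  define T s d where "T = complex_of_real t" and "s = 1 + T\<^sup>2" and "d = T - z"
  have "1 + t\<^sup>2 \<noteq> 0" by (metis power_one sum_power2_eq_zero_iff zero_neq_one)
  then have "s \<noteq> 0"
    unfolding s_def T_def by (metis of_real_1 of_real_add of_real_eq_0_iff of_real_power)
  have "d \<noteq> 0" using assms by (simp add: d_def T_def)
  have "(1 + t\<^sup>2) *\<^sub>R (1 / (of_real t - z) - of_real (t / (1 + t\<^sup>2))) = s * (1 / d - T / s)"
    by (simp add: scaleR_conv_of_real s_def d_def T_def)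
  also have "\<dots> = s / d - T" using \<open>s \<noteq> 0\<close> by (simp add: right_diff_distrib)
  also have "s = (T + z) * d + (1 + z\<^sup>2)"
    by (simp add: s_def d_def power2_eq_square algebra_simps)
  also have "\<dots> / d - T = z + (1 + z\<^sup>2) / d"
    using \<open>d \<noteq> 0\<close> by (simp add: add_divide_distrib)
  finally show ?thesis by (simp add: d_def T_def)
qed

lemma nevanlinna_kernel_Im:
  "Im (z + (1 + z\<^sup>2) / (of_real t - z)) = Im z * ((1 + t\<^sup>2) / (cmod (of_real t - z))\<^sup>2)"
proof (cases "complex_of_real t = z")
  case True
  then have "Im z = 0" by (metis Im_complex_of_real)
  with True show ?thesis by simp
next
  case False
  define d where "d = (cmod (of_real t - z))\<^sup>2"
  have d: "d = (t - Re z)\<^sup>2 + (Im z)\<^sup>2" by (simp add: d_def cmod_power2)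
  have "d \<noteq> 0" using False by (simp add: d_def)
  have "z + (1 + z\<^sup>2) / (of_real t - z) = (1 + of_real t * z) / (of_real t - z)"
    using False by (simp add: field_simps power2_eq_square)
  also have "\<dots> = (1 + of_real t * z) * cnj (of_real t - z) / of_real d"
    unfolding d_def complex_norm_square
  proof (rule mult_divide_mult_cancel_right[symmetric])
    show "cnj (of_real t - z) \<noteq> 0" using False by (metis complex_cnj_zero_iff eq_iff_diff_eq_0)
  qed
  finally have "Im (z + (1 + z\<^sup>2) / (of_real t - z)) = Im ((1 + of_real t * z) * cnj (of_real t - z)) / d"
    by (simp add: Im_divide_of_real)
  also have "Im ((1 + of_real t * z) * cnj (of_real t - z)) = Im z * (1 + t\<^sup>2)"
    by (simp add: power2_eq_square algebra_simps)
  finally show ?thesis by (simp add: d_def)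
qed

lemma continuous_on_kernel:
  assumes "Im z \<noteq> 0"
  shows "continuous_on UNIV (\<lambda>t. z + (1 + z\<^sup>2) / (of_real t - z))"
proof -
  have "of_real t - z \<noteq> 0" for t using assms by auto
  then show ?thesis by (intro continuous_intros) auto
qed

lemma kernel_norm_le:
  assumes "Im z \<noteq> 0"
  shows "norm (z + (1 + z\<^sup>2) / (of_real t - z)) \<le> cmod z + cmod (1 + z\<^sup>2) / \<bar>Im z\<bar>"
proof -
  have "\<bar>Im z\<bar> \<le> cmod (of_real t - z)" using abs_Im_le_cmod[of "of_real t - z"] by simp
  then have "cmod (1 + z\<^sup>2) / cmod (of_real t - z) \<le> cmod (1 + z\<^sup>2) / \<bar>Im z\<bar>"
    using assms by (intro divide_left_mono mult_pos_pos) auto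
  then show ?thesis
    by (intro order_trans[OF norm_triangle_ineq]) (simp add: norm_divide)
qed

context
  fixes A :: "'a::complex_hilbert_space opgraph" and g :: 'a
  assumes sa: "self_adjoint A" and g: "norm g = 1"
begin

lemma i_resolvent: "\<i> \<in> resolvent_set A"
  by (rule sa_nonreal_resolvent[OF sa]) simp

lemma cayley_add: "cayley A (x + y) = cayley A x + cayley A y"
  by (simp add: cayley_def resolvent_add[OF i_resolvent] scaleC_simps)

lemma cayley_scale: "cayley A (a *\<^sub>C x) = a *\<^sub>C cayley A x"
  by (simp add: cayley_def resolvent_scale[OF sa_linear[OF sa] i_resolvent] scaleC_simps mult.commute)

text \<open>With x = (A - i)u, the claim compares (A + i)u with (A - i)u; symmetry of A cancels the cross
  terms.\<close>

lemma cayley_isometry: "cinner (cayley A x) (cayley A y) = cinner x y"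
proof -
  define u v where "u = resolvent A \<i> x" and "v = resolvent A \<i> y"
  have "(u, x + \<i> *\<^sub>C u) \<in> A" "(v, y + \<i> *\<^sub>C v) \<in> A"
    by (simp_all add: u_def v_def resolvent_in_graph[OF i_resolvent])
  from sa_symmetric[OF sa this] have "cinner x v = cinner u y - 2 * \<i> * cinner u v"
    by (simp add: cinner_linear algebra_simps)
  then show ?thesis
    by (simp add: cayley_def cinner_linear algebra_simps flip: u_def v_def)
qed

text \<open>V - 1 = 2i (A - i)^{-1} has the domain of A as its range.\<close>

lemma cayley_diff_range: "closure (range (\<lambda>y. cayley A y - y)) = UNIV"
proof -
  have "Domain A \<subseteq> range (\<lambda>y. cayley A y - y)"
  proof
    fix x assume dom: "x \<in> Domain A"
    obtain x' where x: "(x, x') \<in> A" using dom by blast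
    define y where "y = inverse (2 * \<i>) *\<^sub>C (x' - \<i> *\<^sub>C x)"
    have "resolvent A \<i> (x' - \<i> *\<^sub>C x) = x"
      by (rule resolvent_eqI[OF i_resolvent x]) simp
    then have "cayley A y - y = x"
      unfolding y_def cayley_def resolvent_scale[OF sa_linear[OF sa] i_resolvent]
      by (simp add: scaleC_scaleC scaleC_one)
    then show "x \<in> range (\<lambda>y. cayley A y - y)" by (rule range_eqI[OF sym])
  qed
  then have "closure (Domain A) \<subseteq> closure (range (\<lambda>y. cayley A y - y))"
    by (rule closure_mono)
  then show ?thesis
    using sa_dense[OF sa] unfolding densely_defined_def by (metis top.extremum_uniqueI)
qed

text \<open>1 - \<zeta> V with \<zeta> = (z - i)/(z + i) is 2i/(z + i) times (A - z)(A - i)^{-1}, whose inverse carries g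
  to its deficiency vector at z.\<close>

lemma cayley_deficiency_vector:
  assumes z: "z \<in> resolvent_set A" and "z \<noteq> - \<i>"
  defines "x \<equiv> ((z + \<i>) / (2 * \<i>)) *\<^sub>C deficiency_vector A g z"
  shows "x - ((z - \<i>) / (z + \<i>)) *\<^sub>C cayley A x = g"
proof -
  define u where "u = resolvent A z g"
  define d where "d = deficiency_vector A g z"
  have zi: "z + \<i> \<noteq> 0" using \<open>z \<noteq> - \<i>\<close> by (simp add: eq_neg_iff_add_eq_0)
  have "deficiency_vector A g \<i> = g" by (simp add: deficiency_vector_def)
  with deficiency_vector_shift[OF sa z i_resolvent, of g]
  have "(\<i> - z) *\<^sub>C resolvent A \<i> d = - ((z - \<i>) *\<^sub>C u)"
    by (simp add: d_def u_def deficiency_vector_def algebra_simps)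
  then have R: "(z - \<i>) *\<^sub>C resolvent A \<i> d = (z - \<i>) *\<^sub>C u"
    by (simp add: complex_vector.scale_left_diff_distrib algebra_simps)
  have "cayley A d = d + (2 * \<i>) *\<^sub>C resolvent A \<i> d" by (simp add: cayley_def)
  then have "(z - \<i>) *\<^sub>C cayley A d = (z - \<i>) *\<^sub>C d + (2 * \<i>) *\<^sub>C ((z - \<i>) *\<^sub>C resolvent A \<i> d)"
    by (simp add: scaleC_add_right scaleC_scaleC mult.commute)
  also have "\<dots> = (z - \<i>) *\<^sub>C d + (2 * \<i>) *\<^sub>C (d - g)"
    unfolding R by (simp add: d_def u_def deficiency_vector_def)
  also have "\<dots> = (z + \<i>) *\<^sub>C d - (2 * \<i>) *\<^sub>C g"
    by (simp add: scaleC_simps algebra_simps) (simp add: scaleC_add_left[symmetric])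
  finally have c: "(z - \<i>) *\<^sub>C cayley A d = (z + \<i>) *\<^sub>C d - (2 * \<i>) *\<^sub>C g" .
  have "(z - \<i>) / (z + \<i>) * ((z + \<i>) / (2 * \<i>)) = inverse (2 * \<i>) * (z - \<i>)"
    by (simp only: times_divide_times_eq mult.commute[of "z + \<i>"] mult_divide_mult_cancel_right[OF zi])
      (simp only: divide_inverse mult.commute)
  then have "((z - \<i>) / (z + \<i>)) *\<^sub>C cayley A x = inverse (2 * \<i>) *\<^sub>C ((z - \<i>) *\<^sub>C cayley A d)"
    by (simp only: x_def d_def cayley_scale scaleC_scaleC)
  also have "\<dots> = x - g"
  proof -
    have 1: "inverse (2 * \<i>) * (z + \<i>) = (z + \<i>) / (2 * \<i>)"
      by (simp only: divide_inverse mult.commute)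
    have 2: "inverse (2 * \<i>) * (2 * \<i>) = 1" by simp
    show ?thesis
      unfolding c unfolding complex_vector.scale_right_diff_distrib scaleC_scaleC 1 2 scaleC_one
      by (simp only: x_def d_def)
  qed
  finally show ?thesis by simp
qed

text \<open>The map t = i (w + 1)/(w - 1), inverse to w = (t + i)/(t - i), carries the moment measure from the
  circle to the line. It is defined almost everywhere: the point w = 1, which would correspond to
  infinity, has no mass because the domain of A is dense.\<close>

lemma weyl_titchmarsh_upper_integral:
  obtains \<nu> :: "real measure" where "real_distribution \<nu>"
    "\<And>z. 0 < Im z \<Longrightarrow> weyl_titchmarsh A g z = (LINT t|\<nu>. z + (1 + z\<^sup>2) / (of_real t - z))"
proof -
  obtain m where m: "real_distribution m"
    and mom: "\<And>n. (LINT \<theta>|m. cis (real n * \<theta>)) = cinner ((cayley A ^^ n) g) g"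
    by (rule trigonometric_moments[OF cayley_add cayley_scale cayley_isometry g]) blast
  interpret m: real_distribution m by (rule m)
  have AE1: "AE \<theta> in m. cis \<theta> \<noteq> 1"
    by (rule no_atom_at_1[OF cayley_add cayley_scale cayley_isometry m mom])
      (simp add: cayley_diff_range)
  \<comment> \<open>division by zero gives the value 0 on the null set where cis \<theta> = 1\<close>
  define \<tau> where "\<tau> \<theta> = Re (\<i> * (cis \<theta> + 1) / (cis \<theta> - 1))" for \<theta>
  have \<tau>_meas: "\<tau> \<in> measurable m borel"
  proof -
    have "cis \<in> borel_measurable borel"
      by (intro borel_measurable_continuous_onI continuous_intros)
    then show ?thesis
      unfolding \<tau>_def measurable_cong_sets[OF m.events_eq_borel refl] by measurable
  qed
  define \<nu> where "\<nu> = distr m borel \<tau>"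
  have "real_distribution \<nu>"
    unfolding \<nu>_def using m.real_distribution_distr \<tau>_meas by simp
  moreover have "weyl_titchmarsh A g z = (LINT t|\<nu>. z + (1 + z\<^sup>2) / (of_real t - z))" if z: "0 < Im z" for z
  proof -
    have res: "z \<in> resolvent_set A" using z by (intro sa_nonreal_resolvent[OF sa]) simp
    have zi: "z \<noteq> - \<i>" "z + \<i> \<noteq> 0" using z by (auto simp: complex_eq_iff)
    define \<zeta> where "\<zeta> = (z - \<i>) / (z + \<i>)"
    have "(cmod (z - \<i>))\<^sup>2 < (cmod (z + \<i>))\<^sup>2"
      using z unfolding cmod_power2 by (simp add: power2_eq_square algebra_simps)
    then have "cmod (z - \<i>) < cmod (z + \<i>)" by (rule power2_less_imp_less) simp
    then have \<zeta>: "cmod \<zeta> < 1" using zi by (simp add: \<zeta>_def norm_divide)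
    have "cinner (((z + \<i>) / (2 * \<i>)) *\<^sub>C deficiency_vector A g z) g = (LINT \<theta>|m. 1 / (1 - \<zeta> * cis \<theta>))"
      by (rule resolvent_moment[OF cayley_add cayley_scale cayley_isometry m mom \<zeta>])
        (unfold \<zeta>_def, rule cayley_deficiency_vector[OF res zi(1)])
    then have "weyl_titchmarsh A g z + \<i> = 2 * \<i> * (LINT \<theta>|m. 1 / (1 - \<zeta> * cis \<theta>))"
      unfolding weyl_titchmarsh_deficiency_vector[OF sa res g]
      by (simp add: cinner_scaleC_left field_simps)
    also have "\<dots> = (LINT \<theta>|m. 2 * \<i> * (1 / (1 - \<zeta> * cis \<theta>)))"
      by (rule integral_mult_right_zero[symmetric])
    also have "\<dots> = (LINT \<theta>|m. \<i> + (z + (1 + z\<^sup>2) / (of_real (\<tau> \<theta>) - z)))"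
    proof (rule integral_cong_AE)
      have nz: "1 - \<zeta> * cis \<theta> \<noteq> 0" for \<theta>
      proof
        assume "1 - \<zeta> * cis \<theta> = 0"
        then have "cmod (\<zeta> * cis \<theta>) = 1" by (metis eq_iff_diff_eq_0 norm_one)
        with \<zeta> show False by (simp add: norm_mult)
      qed
      show "(\<lambda>\<theta>. 2 * \<i> * (1 / (1 - \<zeta> * cis \<theta>))) \<in> borel_measurable m"
        unfolding measurable_cong_sets[OF m.events_eq_borel refl]
        using nz by (intro borel_measurable_continuous_onI continuous_intros) auto
      show "(\<lambda>\<theta>. \<i> + (z + (1 + z\<^sup>2) / (of_real (\<tau> \<theta>) - z))) \<in> borel_measurable m"
        using \<tau>_meas by measurable
      show "AE \<theta> in m. 2 * \<i> * (1 / (1 - \<zeta> * cis \<theta>)) = \<i> + (z + (1 + z\<^sup>2) / (of_real (\<tau> \<theta>) - z))"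
        using AE1
      proof eventually_elim
        fix \<theta> assume ne: "cis \<theta> \<noteq> 1"
        define w where "w = cis \<theta>"
        have w: "w \<noteq> 1" "w \<noteq> 0" "cnj w = inverse w"
          using ne by (simp_all add: w_def cis_cnj cis_inverse)
        define t where "t = \<i> * (w + 1) / (w - 1)"
        have "cnj t = t"
          unfolding t_def using w by (simp add: field_simps)
        then have t: "of_real (\<tau> \<theta>) = t"
          unfolding \<tau>_def w_def[symmetric] t_def[symmetric] by (simp add: complex_eq_iff)
        have "t - z \<noteq> 0" using z unfolding t[symmetric] by auto
        have "(1 - \<zeta> * w) * ((z + \<i>) * (w - 1) * (t - \<i>)) = (w - 1) * (2 * \<i> * (t - z))"
        proof -
          have 1: "(w - 1) * (t - \<i>) = 2 * \<i>" and 2: "w * (t - \<i>) = t + \<i>"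
            using w by (simp_all add: t_def field_simps)
          have 3: "(z + \<i>) * \<zeta> = z - \<i>" using zi by (simp add: \<zeta>_def)
          have "(1 - \<zeta> * w) * ((z + \<i>) * (w - 1) * (t - \<i>))
              = (w - 1) * ((z + \<i>) * (t - \<i>) - ((z + \<i>) * \<zeta>) * (w * (t - \<i>)))"
            by (simp add: algebra_simps)
          also have "\<dots> = (w - 1) * (2 * \<i> * (t - z))"
            unfolding 2 3 by (simp add: algebra_simps)
          finally show ?thesis .
        qed
        then have "(1 - \<zeta> * w) * ((z + \<i>) * (t - \<i>)) = 2 * \<i> * (t - z)"
          using w by (simp add: mult_ac)
        then have "2 * \<i> / (1 - \<zeta> * w) = (z + \<i>) * (t - \<i>) / (t - z)"
          using nz[of \<theta>] \<open>t - z \<noteq> 0\<close> unfolding w_def[symmetric] by (simp add: field_simps)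
        also have "\<dots> = \<i> + (z + (1 + z\<^sup>2) / (t - z))"
          using \<open>t - z \<noteq> 0\<close> by (simp add: field_simps) (simp add: power2_eq_square algebra_simps)
        finally show "2 * \<i> * (1 / (1 - \<zeta> * cis \<theta>)) = \<i> + (z + (1 + z\<^sup>2) / (of_real (\<tau> \<theta>) - z))"
          unfolding t w_def by simp
      qed
    qed
    also have "\<dots> = (LINT \<theta>|m. \<i>) + (LINT \<theta>|m. z + (1 + z\<^sup>2) / (of_real (\<tau> \<theta>) - z))"
    proof (rule Bochner_Integration.integral_add)
      show "integrable m (\<lambda>\<theta>. z + (1 + z\<^sup>2) / (of_real (\<tau> \<theta>) - z))"
      proof (rule m.integrable_const_bound[where B = "cmod z + cmod (1 + z\<^sup>2) / \<bar>Im z\<bar>"])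
        show "AE \<theta> in m. norm (z + (1 + z\<^sup>2) / (of_real (\<tau> \<theta>) - z)) \<le> cmod z + cmod (1 + z\<^sup>2) / \<bar>Im z\<bar>"
          by (intro AE_I2 kernel_norm_le) (use z in simp)
      qed (use \<tau>_meas in measurable)
    qed simp
    also have "(LINT \<theta>|m. z + (1 + z\<^sup>2) / (of_real (\<tau> \<theta>) - z)) = (LINT t|\<nu>. z + (1 + z\<^sup>2) / (of_real t - z))"
      unfolding \<nu>_def using z
      by (subst integral_distr[OF \<tau>_meas])
        (auto intro!: borel_measurable_continuous_onI continuous_on_kernel)
    also have "(LINT \<theta>|m. \<i>) = \<i>" using m.prob_space by simp
    finally show ?thesis by simp
  qed
  ultimately show ?thesis using that by blast
qed

end

text \<open>At a real point x of the resolvent set the mass near x is controlled by the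
  deficiency vectors at x + i/(n + 1), whose norms stay bounded, through monotone convergence.\<close>

context
  fixes A :: "'a::complex_hilbert_space opgraph" and g :: 'a and \<nu> :: "real measure"
  assumes sa: "self_adjoint A" and g: "norm g = 1" and \<nu>: "real_distribution \<nu>"
    and upper: "0 < Im z \<Longrightarrow> weyl_titchmarsh A g z = (LINT t|\<nu>. z + (1 + z\<^sup>2) / (of_real t - z))"
begin

interpretation real_distribution \<nu> by (rule \<nu>)

lemma kernel_integrable_nonreal:
  assumes "Im z \<noteq> 0"
  shows "integrable \<nu> (\<lambda>t. z + (1 + z\<^sup>2) / (of_real t - z))"
  by (rule integrable_const_bound[where B = "cmod z + cmod (1 + z\<^sup>2) / \<bar>Im z\<bar>"])
    (use assms in \<open>auto simp: kernel_norm_le measurable_cong_sets[OF events_eq_borel refl]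
      intro!: borel_measurable_continuous_onI continuous_on_kernel\<close>)

lemma weyl_titchmarsh_nonreal_integral:
  assumes "Im z \<noteq> 0"
  shows "weyl_titchmarsh A g z = (LINT t|\<nu>. z + (1 + z\<^sup>2) / (of_real t - z))"
proof (cases "0 < Im z")
  case False
  have res: "cnj z \<in> resolvent_set A" using assms by (intro sa_nonreal_resolvent[OF sa]) simp
  have "weyl_titchmarsh A g z = cnj (weyl_titchmarsh A g (cnj z))"
    using weyl_titchmarsh_cnj[OF sa res g] by simp
  also have "weyl_titchmarsh A g (cnj z) = (LINT t|\<nu>. cnj z + (1 + (cnj z)\<^sup>2) / (of_real t - cnj z))"
    using False assms by (intro upper) auto
  also have "cnj \<dots> = (LINT t|\<nu>. z + (1 + z\<^sup>2) / (of_real t - z))"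
    by (simp flip: Bochner_Integration.integral_cnj)
  finally show ?thesis .
qed (rule upper)

text \<open>Take imaginary parts in the integral representation and divide by Im z.\<close>

lemma deficiency_norm_nonreal_integral:
  assumes z: "Im z \<noteq> 0"
  shows "has_bochner_integral \<nu> (\<lambda>t. (1 + t\<^sup>2) / (cmod (of_real t - z))\<^sup>2) ((norm (deficiency_vector A g z))\<^sup>2)"
proof -
  have res: "z \<in> resolvent_set A" by (rule sa_nonreal_resolvent[OF sa z])
  have "has_bochner_integral \<nu> (\<lambda>t. z + (1 + z\<^sup>2) / (of_real t - z)) (weyl_titchmarsh A g z)"
    using kernel_integrable_nonreal[OF z] weyl_titchmarsh_nonreal_integral[OF z]
    by (simp add: has_bochner_integral_iff)
  from has_bochner_integral_bounded_linear[OF bounded_linear_Im this]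
  have "has_bochner_integral \<nu> (\<lambda>t. Im z * ((1 + t\<^sup>2) / (cmod (of_real t - z))\<^sup>2))
      (Im z * (norm (deficiency_vector A g z))\<^sup>2)"
    unfolding nevanlinna_kernel_Im weyl_titchmarsh_Im[OF sa res g] .
  from has_bochner_integral_mult_right[OF this, of "inverse (Im z)"] z
  show ?thesis by (simp add: mult.assoc[symmetric])
qed

lemma real_approach:
  assumes "z \<in> resolvent_set A" "Im z = 0"
  shows "(\<lambda>n. deficiency_vector A g (z + \<i> * of_real (inverse (real (Suc n))))) \<longlonglongrightarrow> deficiency_vector A g z"
proof -
  have "(\<lambda>n. z + \<i> * of_real (inverse (real (Suc n)))) \<longlonglongrightarrow> z + \<i> * of_real 0"
    by (intro tendsto_intros LIMSEQ_inverse_real_of_nat)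
  moreover have "z + \<i> * of_real (inverse (real (Suc n))) \<noteq> z" for n by (simp del: of_nat_Suc)
  ultimately have "filterlim (\<lambda>n. z + \<i> * of_real (inverse (real (Suc n)))) (at z) sequentially"
    by (auto simp: filterlim_at)
  then show ?thesis
    using filterlim_compose[OF deficiency_vector_continuous[OF sa assms(1)]] by blast
qed

lemma deficiency_norm_integral:
  assumes res: "z \<in> resolvent_set A"
  shows "has_bochner_integral \<nu> (\<lambda>t. (1 + t\<^sup>2) / (cmod (of_real t - z))\<^sup>2) ((norm (deficiency_vector A g z))\<^sup>2)"
    and "AE t in \<nu>. of_real t \<noteq> z"
proof -
  have "has_bochner_integral \<nu> (\<lambda>t. (1 + t\<^sup>2) / (cmod (of_real t - z))\<^sup>2) ((norm (deficiency_vector A g z))\<^sup>2)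
      \<and> (AE t in \<nu>. of_real t \<noteq> z)"
  proof (cases "Im z = 0")
    case False
    then have "of_real t \<noteq> z" for t by auto
    with deficiency_norm_nonreal_integral[OF False] show ?thesis by simp
  next
    case True
    define x where "x = Re z"
    have zx: "z = of_real x" using True by (simp add: x_def complex_eq_iff)
    define e where "e n = inverse (real (Suc n))" for n
    define w where "w n = z + \<i> * of_real (e n)" for n
    define k where "k n t = (1 + t\<^sup>2) / ((t - x)\<^sup>2 + (e n)\<^sup>2)" for n t
    have e: "0 < e n" for n by (simp add: e_def)
    have k_eq: "k n t = (1 + t\<^sup>2) / (cmod (of_real t - w n))\<^sup>2" for n t
      by (simp add: k_def w_def zx cmod_power2)
    have k: "has_bochner_integral \<nu> (k n) ((norm (deficiency_vector A g (w n)))\<^sup>2)" for n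
      unfolding k_eq[abs_def] using e[of n]
      by (intro deficiency_norm_nonreal_integral) (simp add: w_def zx)
    have lim: "(\<lambda>n. (norm (deficiency_vector A g (w n)))\<^sup>2) \<longlonglongrightarrow> (norm (deficiency_vector A g z))\<^sup>2"
      unfolding w_def e_def by (intro tendsto_intros real_approach res True)
    then obtain K where K: "\<And>n. (norm (deficiency_vector A g (w n)))\<^sup>2 \<le> K"
      using convergent_imp_Bseq[OF convergentI[OF lim]] unfolding Bseq_def
      by (metis abs_le_iff real_norm_def)
    have "measure \<nu> {x} = 0"
    proof (rule ccontr)
      assume "measure \<nu> {x} \<noteq> 0"
      then have p: "0 < measure \<nu> {x}" using measure_nonneg[of \<nu> "{x}"] by linarith
      have bound: "measure \<nu> {x} * (1 + x\<^sup>2) * (real (Suc n))\<^sup>2 \<le> K" for n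
      proof -
        have "measure \<nu> {x} * k n x = (LINT t|\<nu>. indicator {x} t * k n x)"
          by simp
        also have "\<dots> \<le> (LINT t|\<nu>. k n t)"
        proof (rule integral_mono)
          show "integrable \<nu> (k n)" using k by (simp add: has_bochner_integral_iff)
          show "indicator {x} t * k n x \<le> k n t" for t
            by (auto simp: indicator_def k_def)
        qed (auto simp: emeasure_eq_measure)
        also have "\<dots> \<le> K" using K[of n] k[of n] by (simp add: has_bochner_integral_iff)
        finally show ?thesis by (simp add: k_def e_def field_simps)
      qed
      obtain n where n: "K / (measure \<nu> {x} * (1 + x\<^sup>2)) < real n"
        using reals_Archimedean2 by blast
      have c: "0 < measure \<nu> {x} * (1 + x\<^sup>2)"
        using p by (intro mult_pos_pos add_pos_nonneg) auto
      have "K < measure \<nu> {x} * (1 + x\<^sup>2) * real n"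
        using n c by (simp add: field_simps)
      also have "\<dots> \<le> measure \<nu> {x} * (1 + x\<^sup>2) * (real (Suc n))\<^sup>2"
      proof (rule mult_left_mono)
        show "real n \<le> (real (Suc n))\<^sup>2" by (simp add: power2_eq_square algebra_simps)
      qed (use c in simp)
      finally show False using bound[of n] by simp
    qed
    then have null: "{x} \<in> null_sets \<nu>" by (simp add: null_sets_def emeasure_eq_measure)
    have AEx: "AE t in \<nu>. t \<noteq> x" using AE_not_in[OF null] by simp
    have kmono: "AE t in \<nu>. mono (\<lambda>n. k n t)"
      using AEx
    proof eventually_elim
      case (elim t)
      show ?case
      proof (rule monoI)
        fix i j :: nat assume "i \<le> j"
        then have "e j \<le> e i" by (simp add: e_def)
        then have "(e j)\<^sup>2 \<le> (e i)\<^sup>2" using e[of j] by (intro power_mono) auto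
        then show "k i t \<le> k j t"
          unfolding k_def using elim by (intro divide_left_mono mult_pos_pos add_pos_nonneg) auto
      qed
    qed
    have klim: "AE t in \<nu>. (\<lambda>n. k n t) \<longlonglongrightarrow> (1 + t\<^sup>2) / (cmod (of_real t - z))\<^sup>2"
      using AEx
    proof eventually_elim
      case (elim t)
      have "(\<lambda>n. k n t) \<longlonglongrightarrow> (1 + t\<^sup>2) / ((t - x)\<^sup>2 + 0\<^sup>2)"
        unfolding k_def e_def using elim by (intro tendsto_intros LIMSEQ_inverse_real_of_nat) auto
      then show ?case
        by (simp add: zx flip: of_real_diff)
    qed
    have int: "integrable \<nu> (k n)" "(LINT t|\<nu>. k n t) = (norm (deficiency_vector A g (w n)))\<^sup>2" for n
      using k[of n] by (simp_all add: has_bochner_integral_iff)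
    have meas: "(\<lambda>t. (1 + t\<^sup>2) / (cmod (of_real t - z))\<^sup>2) \<in> borel_measurable \<nu>"
      by measurable
    have "has_bochner_integral \<nu> (\<lambda>t. (1 + t\<^sup>2) / (cmod (of_real t - z))\<^sup>2) ((norm (deficiency_vector A g z))\<^sup>2)"
      by (rule has_bochner_integral_monotone_convergence[OF int(1) kmono klim _ meas])
        (simp add: int(2) lim)
    moreover have "AE t in \<nu>. of_real t \<noteq> z"
      using AEx by eventually_elim (simp add: zx)
    ultimately show ?thesis by blast
  qed
  then show "has_bochner_integral \<nu> (\<lambda>t. (1 + t\<^sup>2) / (cmod (of_real t - z))\<^sup>2) ((norm (deficiency_vector A g z))\<^sup>2)"
    and "AE t in \<nu>. of_real t \<noteq> z" by blast+
qed

text \<open>At a real point z the kernels at z + i/(n + 1) are dominated through 1/|t - z|, which is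
  integrable because it is at most 1 + 1/|t - z|^2.\<close>

lemma weyl_titchmarsh_integral:
  assumes res: "z \<in> resolvent_set A"
  shows "has_bochner_integral \<nu> (\<lambda>t. z + (1 + z\<^sup>2) / (of_real t - z)) (weyl_titchmarsh A g z)"
proof (cases "Im z = 0")
  case False
  then show ?thesis
    using kernel_integrable_nonreal weyl_titchmarsh_nonreal_integral
    by (simp add: has_bochner_integral_iff)
next
  case True
  define x where "x = Re z"
  have zx: "z = of_real x" using True by (simp add: x_def complex_eq_iff)
  define w where "w n = z + \<i> * of_real (inverse (real (Suc n)))" for n
  have w_im: "Im (w n) \<noteq> 0" for n by (simp add: w_def zx)
  have w_lim: "w \<longlonglongrightarrow> z"
  proof -
    have "w \<longlonglongrightarrow> z + \<i> * of_real 0"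
      unfolding w_def by (intro tendsto_intros LIMSEQ_inverse_real_of_nat)
    then show ?thesis by simp
  qed
  have AEz: "AE t in \<nu>. of_real t \<noteq> z" by (rule deficiency_norm_integral(2)[OF res])
  define C where "C = (cmod z + 1) + (1 + (cmod z + 1)\<^sup>2) * 2"
  have w_norm: "cmod (w n) \<le> cmod z + 1" for n
  proof -
    have "inverse (real (Suc n)) \<le> 1" by (simp add: field_simps)
    then have "cmod (\<i> * of_real (inverse (real (Suc n)))) \<le> 1"
      by (simp add: norm_mult norm_inverse del: of_nat_Suc)
    then show ?thesis
      unfolding w_def using norm_triangle_ineq[of z "\<i> * of_real (inverse (real (Suc n)))"] by linarith
  qed
  define D where "D t = (cmod z + 1) + (1 + (cmod z + 1)\<^sup>2) * (1 + (1 + t\<^sup>2) / (cmod (of_real t - z))\<^sup>2)" for t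
  have bound: "AE t in \<nu>. norm (w n + (1 + (w n)\<^sup>2) / (of_real t - w n)) \<le> D t" for n
    using AEz
  proof eventually_elim
    case (elim t)
    have d: "0 < cmod (of_real t - z)" using elim by simp
    have "\<bar>t - x\<bar> = \<bar>Re (of_real t - w n)\<bar>" by (simp add: w_def zx)
    also have "\<dots> \<le> cmod (of_real t - w n)" by (rule abs_Re_le_cmod)
    finally have le: "cmod (of_real t - z) \<le> cmod (of_real t - w n)"
      by (simp add: zx flip: of_real_diff)
    have "cmod (1 + (w n)\<^sup>2) \<le> 1 + (cmod (w n))\<^sup>2"
      using norm_triangle_ineq[of 1 "(w n)\<^sup>2"] by (simp add: norm_power)
    also have "\<dots> \<le> 1 + (cmod z + 1)\<^sup>2" using w_norm[of n] by (simp add: power_mono)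
    finally have 1: "cmod (1 + (w n)\<^sup>2) \<le> 1 + (cmod z + 1)\<^sup>2" .
    have "1 / cmod (of_real t - w n) \<le> 1 / cmod (of_real t - z)"
      using le d by (intro divide_left_mono mult_pos_pos) auto
    also have "\<dots> \<le> 1 + (1 / cmod (of_real t - z))\<^sup>2"
    proof -
      have "0 \<le> (1 / cmod (of_real t - z) - 1 / 2)\<^sup>2" by simp
      then show ?thesis by (simp add: power2_eq_square algebra_simps)
    qed
    also have "\<dots> \<le> 1 + (1 + t\<^sup>2) / (cmod (of_real t - z))\<^sup>2"
      by (simp add: power_divide divide_right_mono)
    finally have 2: "1 / cmod (of_real t - w n) \<le> 1 + (1 + t\<^sup>2) / (cmod (of_real t - z))\<^sup>2" .
    have "norm (w n + (1 + (w n)\<^sup>2) / (of_real t - w n))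
        \<le> cmod (w n) + cmod (1 + (w n)\<^sup>2) * (1 / cmod (of_real t - w n))"
      using norm_triangle_ineq[of "w n" "(1 + (w n)\<^sup>2) / (of_real t - w n)"] by (simp add: norm_divide)
    also have "\<dots> \<le> D t"
      unfolding D_def by (intro add_mono mult_mono w_norm 1 2) auto
    finally show ?case .
  qed
  have D: "integrable \<nu> D"
    unfolding D_def using deficiency_norm_integral(1)[OF res]
    by (intro Bochner_Integration.integrable_add integrable_mult_right)
      (simp_all add: has_bochner_integral_iff)
  have lim: "AE t in \<nu>. (\<lambda>n. w n + (1 + (w n)\<^sup>2) / (of_real t - w n)) \<longlonglongrightarrow> z + (1 + z\<^sup>2) / (of_real t - z)"
    using AEz by eventually_elim (intro tendsto_intros w_lim, simp)
  have meas: "(\<lambda>t. v + (1 + v\<^sup>2) / (of_real t - v)) \<in> borel_measurable \<nu>" for v :: complex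
    by measurable
  note dom = integrable_dominated_convergence[OF meas meas D lim bound]
    integral_dominated_convergence[OF meas meas D lim bound]
  have "(\<lambda>n. (w n + \<i>) * cinner (deficiency_vector A g (w n)) g - \<i>)
      \<longlonglongrightarrow> (z + \<i>) * cinner (deficiency_vector A g z) g - \<i>"
    by (intro tendsto_intros tendsto_cinner w_lim real_approach[OF res True, folded w_def])
  moreover have "(LINT t|\<nu>. w n + (1 + (w n)\<^sup>2) / (of_real t - w n))
      = (w n + \<i>) * cinner (deficiency_vector A g (w n)) g - \<i>" for n
    unfolding weyl_titchmarsh_nonreal_integral[OF w_im, symmetric]
      weyl_titchmarsh_deficiency_vector[OF sa sa_nonreal_resolvent[OF sa w_im] g, symmetric] by simp
  moreover have "weyl_titchmarsh A g z = (z + \<i>) * cinner (deficiency_vector A g z) g - \<i>"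
    unfolding weyl_titchmarsh_deficiency_vector[OF sa res g, symmetric] by simp
  ultimately have "weyl_titchmarsh A g z = (LINT t|\<nu>. z + (1 + z\<^sup>2) / (of_real t - z))"
    using LIMSEQ_unique[OF dom(2)] by simp
  with dom(1) show ?thesis by (simp add: has_bochner_integral_iff)
qed

text \<open>Infinite total mass: the squared norm of g(iy) is the integral of 1/(t^2 + y^2) d\<mu>, at most
  \<mu>(R)/y^2.\<close>

lemma herglotz_nevanlinna_density:
  assumes notin: "g \<notin> Domain A"
  defines "\<mu> \<equiv> density \<nu> (\<lambda>t. ennreal (1 + t\<^sup>2))"
  shows "herglotz_nevanlinna_measure (resolvent_set A) (weyl_titchmarsh A g) \<mu>"
    and "z \<in> resolvent_set A \<Longrightarrow> has_bochner_integral \<mu> (\<lambda>t. 1 / (cmod (of_real t - z))\<^sup>2)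
      ((norm (deficiency_vector A g z))\<^sup>2)"
proof -
  have dens: "has_bochner_integral \<mu> f I \<longleftrightarrow> has_bochner_integral \<nu> (\<lambda>t. (1 + t\<^sup>2) *\<^sub>R f t) I"
    if "f \<in> borel_measurable borel" for f :: "real \<Rightarrow> 'b::{banach, second_countable_topology}" and I
  proof -
    have "integrable \<mu> f \<longleftrightarrow> integrable \<nu> (\<lambda>t. (1 + t\<^sup>2) *\<^sub>R f t)"
      unfolding \<mu>_def by (rule integrable_density) (use that in auto)
    moreover have "integral\<^sup>L \<mu> f = (LINT t|\<nu>. (1 + t\<^sup>2) *\<^sub>R f t)"
      unfolding \<mu>_def by (rule integral_density) (use that in auto)
    ultimately show ?thesis by (simp add: has_bochner_integral_iff)
  qed
  have norm_int: "has_bochner_integral \<mu> (\<lambda>t. 1 / (cmod (of_real t - z))\<^sup>2) ((norm (deficiency_vector A g z))\<^sup>2)"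
    if "z \<in> resolvent_set A" for z
    using deficiency_norm_integral(1)[OF that] by (subst dens) simp_all
  then show "z \<in> resolvent_set A \<Longrightarrow> has_bochner_integral \<mu> (\<lambda>t. 1 / (cmod (of_real t - z))\<^sup>2)
      ((norm (deficiency_vector A g z))\<^sup>2)" .
  have weyl_int: "has_bochner_integral \<mu> (\<lambda>t. 1 / (of_real t - z) - of_real (t / (1 + t\<^sup>2))) (weyl_titchmarsh A g z)"
    if res: "z \<in> resolvent_set A" for z
  proof (subst dens)
    have "has_bochner_integral \<nu> (\<lambda>t. (1 + t\<^sup>2) *\<^sub>R (1 / (of_real t - z) - of_real (t / (1 + t\<^sup>2)))) (weyl_titchmarsh A g z)
      \<longleftrightarrow> has_bochner_integral \<nu> (\<lambda>t. z + (1 + z\<^sup>2) / (of_real t - z)) (weyl_titchmarsh A g z)"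
    proof (rule has_bochner_integral_cong_AE)
      show "AE t in \<nu>. (1 + t\<^sup>2) *\<^sub>R (1 / (of_real t - z) - of_real (t / (1 + t\<^sup>2)))
          = z + (1 + z\<^sup>2) / (of_real t - z)"
        using deficiency_norm_integral(2)[OF res]
        by eventually_elim (rule nevanlinna_kernel)
    qed measurable
    with weyl_titchmarsh_integral[OF res]
    show "has_bochner_integral \<nu> (\<lambda>t. (1 + t\<^sup>2) *\<^sub>R (1 / (of_real t - z) - of_real (t / (1 + t\<^sup>2)))) (weyl_titchmarsh A g z)"
      by blast
  qed measurable
  have unit: "has_bochner_integral \<mu> (\<lambda>t. 1 / (1 + t\<^sup>2)) 1"
  proof (subst dens)
    have "(1 + t\<^sup>2) *\<^sub>R (1 / (1 + t\<^sup>2)) = (1::real)" for t :: real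
      using add_pos_nonneg[of 1 "t\<^sup>2"] by simp
    then show "has_bochner_integral \<nu> (\<lambda>t. (1 + t\<^sup>2) *\<^sub>R (1 / (1 + t\<^sup>2))) (1::real)"
      using prob_space by (simp add: has_bochner_integral_iff)
  qed measurable
  have "emeasure \<mu> UNIV = \<infinity>"
  proof (rule ccontr)
    assume "emeasure \<mu> UNIV \<noteq> \<infinity>"
    then have "finite_measure \<mu>" by (intro finite_measureI) (simp add: \<mu>_def)
    then interpret \<mu>: finite_measure \<mu> .
    have "real (Suc n) * norm (deficiency_vector A g (\<i> * of_nat (Suc n))) \<le> sqrt (measure \<mu> UNIV)" for n
    proof (rule real_le_rsqrt)
      define y where "y = real (Suc n)"
      have y: "0 < y" "\<i> * of_nat (Suc n) = \<i> * complex_of_real y" by (simp_all add: y_def)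
      have res: "\<i> * complex_of_real y \<in> resolvent_set A"
        using y by (intro sa_nonreal_resolvent[OF sa]) simp
      have "(norm (deficiency_vector A g (\<i> * complex_of_real y)))\<^sup>2
          = (LINT t|\<mu>. 1 / (cmod (of_real t - \<i> * complex_of_real y))\<^sup>2)"
        using norm_int[OF res] by (simp add: has_bochner_integral_iff)
      also have "\<dots> \<le> (LINT t|\<mu>. 1 / y\<^sup>2)"
      proof (rule integral_mono)
        show "integrable \<mu> (\<lambda>t. 1 / (cmod (of_real t - \<i> * complex_of_real y))\<^sup>2)"
          using norm_int[OF res] by (simp add: has_bochner_integral_iff)
        show "1 / (cmod (of_real t - \<i> * complex_of_real y))\<^sup>2 \<le> 1 / y\<^sup>2" for t
          using y by (intro divide_left_mono mult_pos_pos) (simp_all add: cmod_power2 add_nonneg_pos)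
      qed simp
      also have "\<dots> = measure \<mu> UNIV / y\<^sup>2" by (simp add: \<mu>_def)
      finally show "(real (Suc n) * norm (deficiency_vector A g (\<i> * of_nat (Suc n))))\<^sup>2 \<le> measure \<mu> UNIV"
        using y unfolding y(2) y_def[symmetric] by (simp add: power_mult_distrib field_simps)
    qed
    from deficiency_vector_bounded_imp_domain[OF sa g this] notin show False by blast
  qed
  with weyl_int unit show "herglotz_nevanlinna_measure (resolvent_set A) (weyl_titchmarsh A g) \<mu>"
    unfolding herglotz_nevanlinna_measure_def has_bochner_integral_iff
    by (auto simp: \<mu>_def)
qed

end

section \<open>Extensions of a symmetric operator with deficiency indices (1,1)\<close>

lemma has_cdim_1_multiple:
  assumes "has_cdim V 1" "x \<in> V" "x \<noteq> 0" "y \<in> V"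
  obtains c where "y = c *\<^sub>C x"
proof -
  obtain b where b: "V = complex_vector.span {b}"
    using assms(1) unfolding has_cdim_def by (metis card_1_singletonE)
  obtain k l where "x = k *\<^sub>C b" "y = l *\<^sub>C b"
    using assms(2,4) unfolding b complex_vector.span_singleton by blast
  with assms(3) have "y = (l / k) *\<^sub>C x" by (auto simp: scaleC_scaleC)
  with that show ?thesis by blast
qed

context
  fixes Adot A :: "'a::complex_hilbert_space opgraph" and gp gm :: 'a
  assumes sym: "symmetric_operator Adot" and closed: "closed Adot"
    and dim: "has_cdim (deficiency_space Adot \<i>) 1"
    and sa: "self_adjoint A" and ext: "Adot \<subseteq> A"
    and gp: "gp \<in> deficiency_space Adot \<i>" and gm: "gm \<in> deficiency_space Adot (- \<i>)"
    and norm_gp: "norm gp = 1" and diff: "gp - gm \<in> Domain A"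
begin

lemma dot_linear: "linear_operator Adot" and dot_dense: "densely_defined Adot"
  using sym by (simp_all add: symmetric_operator_def)

lemma ext_adjoint: "A \<subseteq> adjoint Adot"
  using adjoint_antimono[OF ext] sa_adjoint[OF sa] by simp

lemma gp_adjoint: "(gp, \<i> *\<^sub>C gp) \<in> adjoint Adot" and gm_adjoint: "(gm, (- \<i>) *\<^sub>C gm) \<in> adjoint Adot"
  using gp gm by (simp_all add: deficiency_space_def)

lemma pm_i_resolvent: "\<i> \<in> resolvent_set A" "- \<i> \<in> resolvent_set A"
  by (simp_all add: sa_nonreal_resolvent[OF sa])

text \<open>In the domain of A the vector gp would be an eigenvector for i.\<close>

lemma gp_notin: "gp \<notin> Domain A"
proof
  assume "gp \<in> Domain A"
  then obtain y where y: "(gp, y) \<in> A" by blast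
  with ext_adjoint have "y = \<i> *\<^sub>C gp"
    using adjoint_unique[OF dot_dense _ gp_adjoint] by blast
  with y have "gp = 0"
    using eigenvector_eq_0[OF pm_i_resolvent(1) _ sa_linear[OF sa]] by blast
  with norm_gp show False by simp
qed

lemma diff_mem: "(gp - gm, \<i> *\<^sub>C gp + \<i> *\<^sub>C gm) \<in> A"
proof -
  obtain y where y: "(gp - gm, y) \<in> A" using diff by blast
  have "(gp - gm, \<i> *\<^sub>C gp - (- \<i>) *\<^sub>C gm) \<in> adjoint Adot"
    by (rule adjoint_diff[OF gp_adjoint gm_adjoint])
  with y ext_adjoint have "y = \<i> *\<^sub>C gp - (- \<i>) *\<^sub>C gm"
    using adjoint_unique[OF dot_dense] by blast
  with y show ?thesis by simp
qed

text \<open>The two vectors differ from gp by elements of the domain of A, so their difference is in that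
  domain and would be an eigenvector for -i.\<close>

lemma gm_deficiency_vector: "deficiency_vector A gp (- \<i>) = gm"
proof -
  define u where "u = resolvent A (- \<i>) gp"
  define w where "w = deficiency_vector A gp (- \<i>) - gm"
  have w: "w = (- 2 * \<i>) *\<^sub>C u + (gp - gm)"
    by (simp add: w_def deficiency_vector_def u_def)
  have "(u, gp + (- \<i>) *\<^sub>C u) \<in> A"
    unfolding u_def by (rule resolvent_in_graph[OF pm_i_resolvent(2)])
  from linear_operator_comb[OF sa_linear[OF sa] this diff_mem, of "- 2 * \<i>"]
  have "(w, (- 2 * \<i>) *\<^sub>C (gp + (- \<i>) *\<^sub>C u) + (\<i> *\<^sub>C gp + \<i> *\<^sub>C gm)) \<in> A"
    by (simp only: w)
  moreover have "(- 2 * \<i>) *\<^sub>C (gp + (- \<i>) *\<^sub>C u) + (\<i> *\<^sub>C gp + \<i> *\<^sub>C gm) = (- \<i>) *\<^sub>C w"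
  proof -
    have "(- 2 * \<i>) *\<^sub>C gp + \<i> *\<^sub>C gp = (- \<i>) *\<^sub>C gp"
      by (simp only: scaleC_add_left[symmetric]) simp
    then show ?thesis
      unfolding w by (simp add: scaleC_simps algebra_simps)
  qed
  ultimately have "w = 0"
    using eigenvector_eq_0[OF pm_i_resolvent(2) _ sa_linear[OF sa]] by simp
  then show ?thesis by (simp add: w_def)
qed

lemma deficiency_vector_mem:
  assumes "z \<in> resolvent_set A"
  shows "deficiency_vector A gp z \<in> deficiency_space Adot z"
proof -
  define u where "u = resolvent A z gp"
  have "(u, gp + z *\<^sub>C u) \<in> adjoint Adot"
    using resolvent_in_graph[OF assms, of gp] ext_adjoint unfolding u_def by blast
  from adjoint_comb[OF this gp_adjoint, of "z - \<i>"]
  show ?thesis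
    by (simp add: deficiency_space_def deficiency_vector_def scaleC_simps algebra_simps flip: u_def)
qed

lemma deficiency_vector_nonzero:
  assumes "z \<in> resolvent_set A"
  shows "deficiency_vector A gp z \<noteq> 0"
proof
  assume 0: "deficiency_vector A gp z = 0"
  have "resolvent A \<i> 0 = 0"
    using bounded_linear.linear[OF resolvent_set_resolvent(1)[OF pm_i_resolvent(1)]] by (rule linear_0)
  with deficiency_vector_shift[OF sa assms pm_i_resolvent(1), of gp]
  have "deficiency_vector A gp \<i> = 0" by (simp add: 0)
  with norm_gp show False by (simp add: deficiency_vector_def)
qed

text \<open>The transport I + (i - z)(A - i)^{-1} maps the deficiency space at z into the one at i, which
  is spanned by gp, and the transport back maps gp to its deficiency vector at z.\<close>

lemma deficiency_space_multiple:
  assumes z: "z \<in> resolvent_set A" and h: "h \<in> deficiency_space Adot z"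
  obtains c where "h = c *\<^sub>C deficiency_vector A gp z"
proof -
  define u where "u = resolvent A \<i> h"
  define k where "k = h + (\<i> - z) *\<^sub>C u"
  have k: "k = h - (z - \<i>) *\<^sub>C u"
    by (simp add: k_def complex_vector.scale_left_diff_distrib)
  have "(u, h + \<i> *\<^sub>C u) \<in> adjoint Adot"
    using resolvent_in_graph[OF pm_i_resolvent(1), of h] ext_adjoint unfolding u_def by blast
  moreover have "(h, z *\<^sub>C h) \<in> adjoint Adot" using h by (simp add: deficiency_space_def)
  ultimately have "((\<i> - z) *\<^sub>C u + h, (\<i> - z) *\<^sub>C (h + \<i> *\<^sub>C u) + z *\<^sub>C h) \<in> adjoint Adot"
    by (rule adjoint_comb)
  then have "k \<in> deficiency_space Adot \<i>"
    by (simp add: deficiency_space_def k_def scaleC_simps algebra_simps)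
  moreover have "gp \<noteq> 0" using norm_gp by auto
  ultimately obtain c where c: "k = c *\<^sub>C gp"
    using has_cdim_1_multiple[OF dim gp] by metis
  have "resolvent A z h = u + (z - \<i>) *\<^sub>C resolvent A z u"
    unfolding u_def by (rule resolvent_identity[OF sa_linear[OF sa] pm_i_resolvent(1) z])
  then have "resolvent A z k = u"
    by (simp add: k resolvent_diff[OF z] resolvent_scale[OF sa_linear[OF sa] z])
  then have "c *\<^sub>C resolvent A z gp = u"
    unfolding c resolvent_scale[OF sa_linear[OF sa] z] .
  then have "c *\<^sub>C deficiency_vector A gp z = k + (z - \<i>) *\<^sub>C u"
    unfolding deficiency_vector_def scaleC_add_right c
    by (metis complex_vector.scale_left_commute)
  also have "\<dots> = h" by (simp add: k_def complex_vector.scale_left_diff_distrib)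
  finally show ?thesis using that by metis
qed

text \<open>The range of Adot + i is closed and its orthogonal complement is the line through gp, so this
  range is exactly what is orthogonal to gp.\<close>

lemma mem_dot_if_orthogonal:
  assumes u: "(u, u') \<in> A" and orth: "cinner (u' + \<i> *\<^sub>C u) gp = 0"
  shows "(u, u') \<in> Adot"
proof -
  define R where "R = resolvent A (- \<i>)"
  define S where "S = {f. (R f, f + (- \<i>) *\<^sub>C R f) \<in> Adot}"
  have bl: "bounded_linear R"
    unfolding R_def by (rule resolvent_set_resolvent(1)[OF pm_i_resolvent(2)])
  have R_eq: "R (x' + \<i> *\<^sub>C x) = x" if "(x, x') \<in> A" for x x'
    unfolding R_def by (rule resolvent_eqI[OF pm_i_resolvent(2) that]) simp
  have "closed S"
  proof -
    have "continuous_on UNIV (\<lambda>f. (R f, f + (- \<i>) *\<^sub>C R f))"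
      by (intro continuous_on_Pair continuous_on_add continuous_on_id continuous_on_const
          bounded_bilinear.continuous_on[OF bounded_bilinear_scaleC]
          linear_continuous_on[OF bl])
    then have "closed ((\<lambda>f. (R f, f + (- \<i>) *\<^sub>C R f)) -` Adot)"
      by (rule continuous_on_closed_vimage[OF closed_UNIV, THEN iffD1, rule_format, OF _ closed,
            simplified Int_UNIV_right])
    then show ?thesis by (simp add: S_def vimage_def)
  qed
  moreover have "complex_vector.subspace S"
    unfolding complex_vector.subspace_def
  proof (intro conjI ballI allI)
    have "R 0 = 0" using bl by (simp add: linear_simps(3))
    moreover have "(0, 0) \<in> Adot" using dot_linear by (simp add: linear_operator_def)
    ultimately show "0 \<in> S" by (simp add: S_def)
    show "f + h \<in> S" if "f \<in> S" "h \<in> S" for f h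
      using linear_operator_add[OF dot_linear, of "R f" "f + (- \<i>) *\<^sub>C R f" "R h" "h + (- \<i>) *\<^sub>C R h"] that
      by (simp add: S_def R_def resolvent_add[OF pm_i_resolvent(2)] scaleC_simps algebra_simps)
    show "a *\<^sub>C f \<in> S" if "f \<in> S" for a f
      using linear_operator_scale[OF dot_linear, of "R f" "f + (- \<i>) *\<^sub>C R f" a] that
      by (simp add: S_def R_def resolvent_scale[OF sa_linear[OF sa] pm_i_resolvent(2)]
          scaleC_simps algebra_simps)
  qed
  moreover have "cinner (u' + \<i> *\<^sub>C u) v = 0" if v: "\<And>s. s \<in> S \<Longrightarrow> cinner s v = 0" for v
  proof -
    have "cinner x' v = cinner x (\<i> *\<^sub>C v)" if x: "(x, x') \<in> Adot" for x x'
    proof -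
      have "x' + \<i> *\<^sub>C x \<in> S" using x ext R_eq[of x x'] by (auto simp: S_def)
      from v[OF this] show ?thesis by (simp add: cinner_linear eq_neg_iff_add_eq_0)
    qed
    then have "v \<in> deficiency_space Adot \<i>"
      by (auto simp: deficiency_space_def adjoint_def)
    moreover have "gp \<noteq> 0" using norm_gp by auto
    ultimately obtain c where "v = c *\<^sub>C gp"
      using has_cdim_1_multiple[OF dim gp] by metis
    then show ?thesis using orth by (simp add: cinner_scaleC_right)
  qed
  ultimately have "u' + \<i> *\<^sub>C u \<in> S" by (rule closed_subspace_double_orthogonal)
  then show ?thesis by (simp add: S_def R_eq[OF u])
qed

text \<open>On the domain of A, u is sent to ((A + i)u, gp) by a functional that vanishes on the domain of
  Adot and takes the value 2i at gp - gm.\<close>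

lemma domain_decomposition:
  assumes "(u, u') \<in> A"
  defines "a \<equiv> cinner (u' + \<i> *\<^sub>C u) gp / (2 * \<i>)"
  shows "(u - a *\<^sub>C (gp - gm), u' - a *\<^sub>C (\<i> *\<^sub>C gp + \<i> *\<^sub>C gm)) \<in> Adot"
proof (rule mem_dot_if_orthogonal)
  show "(u - a *\<^sub>C (gp - gm), u' - a *\<^sub>C (\<i> *\<^sub>C gp + \<i> *\<^sub>C gm)) \<in> A"
    by (intro linear_operator_diff linear_operator_scale sa_linear[OF sa] assms diff_mem)
  have "u' - a *\<^sub>C (\<i> *\<^sub>C gp + \<i> *\<^sub>C gm) + \<i> *\<^sub>C (u - a *\<^sub>C (gp - gm))
      = (u' + \<i> *\<^sub>C u) - (2 * \<i> * a) *\<^sub>C gp"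
  proof -
    have "(2 * \<i> * a) *\<^sub>C gp = (\<i> * a) *\<^sub>C gp + (\<i> * a) *\<^sub>C gp"
      by (simp add: scaleC_add_left[symmetric])
    then show ?thesis by (simp add: scaleC_simps algebra_simps)
  qed
  then have "cinner (u' - a *\<^sub>C (\<i> *\<^sub>C gp + \<i> *\<^sub>C gm) + \<i> *\<^sub>C (u - a *\<^sub>C (gp - gm))) gp
      = cinner (u' + \<i> *\<^sub>C u) gp - 2 * \<i> * a * cinner gp gp"
    by (simp only: cinner_diff_left cinner_scaleC_left)
  then show "cinner (u' - a *\<^sub>C (\<i> *\<^sub>C gp + \<i> *\<^sub>C gm) + \<i> *\<^sub>C (u - a *\<^sub>C (gp - gm))) gp = 0"
    using cinner_self[of gp] norm_gp by (simp only: a_def) simp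
qed

text \<open>Any deficiency element is a multiple of g(z), and (z + i)(g(z), gp) = M + i, while the Pick identity
  at w = -i, where M takes the value -i, gives (z - i)(g(z), gm) = M - i.\<close>

lemma livsic_weyl_titchmarsh:
  assumes z: "z \<in> resolvent_set A"
  shows "livsic_infinite Adot gp z \<longleftrightarrow> weyl_titchmarsh A gp z + \<i> = 0"
    and "\<not> livsic_infinite Adot gp z \<Longrightarrow>
      livsic Adot gp gm z = (weyl_titchmarsh A gp z - \<i>) / (weyl_titchmarsh A gp z + \<i>)"
proof -
  define M where "M = weyl_titchmarsh A gp z"
  define h where "h = deficiency_element Adot z"
  have "h \<noteq> 0 \<and> h \<in> deficiency_space Adot z"
    unfolding h_def deficiency_element_def
    by (rule someI[of _ "deficiency_vector A gp z"])
      (simp add: deficiency_vector_nonzero[OF z] deficiency_vector_mem[OF z])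
  then obtain c where c: "h = c *\<^sub>C deficiency_vector A gp z" "c \<noteq> 0"
    using deficiency_space_multiple[OF z] by (metis complex_vector.scale_zero_left)
  have "weyl_titchmarsh A gp (- \<i>) = - \<i>"
    using weyl_titchmarsh_deficiency_vector[OF sa pm_i_resolvent(2) norm_gp]
    by (simp add: eq_neg_iff_add_eq_0)
  then have minus: "(z - \<i>) * cinner h gm = c * (M - \<i>)"
    using weyl_titchmarsh_pick[OF sa z pm_i_resolvent(2) norm_gp]
    by (simp add: c(1) M_def cinner_scaleC_left gm_deficiency_vector mult.left_commute)
  have plus: "(z + \<i>) * cinner h gp = c * (M + \<i>)"
    using weyl_titchmarsh_deficiency_vector[OF sa z norm_gp]
    by (simp add: c(1) M_def cinner_scaleC_left mult.left_commute)
  show "livsic_infinite Adot gp z \<longleftrightarrow> weyl_titchmarsh A gp z + \<i> = 0"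
    using plus c(2) unfolding livsic_infinite_def h_def[symmetric] M_def[symmetric] by simp
  show "livsic Adot gp gm z = (weyl_titchmarsh A gp z - \<i>) / (weyl_titchmarsh A gp z + \<i>)"
    if "\<not> livsic_infinite Adot gp z"
    unfolding livsic_def h_def[symmetric] M_def[symmetric] Let_def times_divide_times_eq minus plus
    using c(2) by simp
qed

context
  fixes Ahat :: "'a opgraph" and \<kappa> :: complex
  assumes hat_linear: "linear_operator Ahat" and hat_ext: "Adot \<subseteq> Ahat"
    and hat_adjoint: "Ahat \<subseteq> adjoint Adot"
    and \<kappa>: "\<kappa> \<noteq> 1" and hat_gp: "gp - \<kappa> *\<^sub>C gm \<in> Domain Ahat"
begin

section \<open>The resolvent formula\<close>

text \<open>Modulo the domain of Adot the vector u - c g(z) is a combination of gp and gm; the condition on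
  c says that this combination is proportional to gp - \<kappa> gm.\<close>

lemma mem_hat:
  assumes z: "z \<in> resolvent_set A" and u: "(u, u') \<in> A"
    and c: "(cinner (u' + \<i> *\<^sub>C u) gp - c * (weyl_titchmarsh A gp z - \<i>)) * (\<kappa> - 1) = 2 * \<i> * c * \<kappa>"
  shows "(u - c *\<^sub>C deficiency_vector A gp z, u' - c *\<^sub>C (z *\<^sub>C deficiency_vector A gp z)) \<in> Ahat"
proof -
  define d where "d = deficiency_vector A gp z"
  define r where "r = resolvent A z gp"
  define v v' where "v = (z - \<i>) *\<^sub>C r" and "v' = (z - \<i>) *\<^sub>C (gp + z *\<^sub>C r)"
  define a b where "a = cinner (u' + \<i> *\<^sub>C u) gp / (2 * \<i>)" and "b = cinner (v' + \<i> *\<^sub>C v) gp / (2 * \<i>)"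
  have v: "(v, v') \<in> A"
    unfolding v_def v'_def r_def
    by (intro linear_operator_scale sa_linear[OF sa] resolvent_in_graph z)
  have d: "d = gp + v" by (simp add: d_def deficiency_vector_def v_def r_def)
  have "cinner (v' + \<i> *\<^sub>C v) gp = weyl_titchmarsh A gp z - \<i>"
    using cinner_self[of gp] norm_gp
    by (simp add: weyl_titchmarsh_resolvent[OF sa z norm_gp] v_def v'_def r_def cinner_linear
        power2_eq_square algebra_simps)
  then have "(2 * \<i> * a - c * (2 * \<i> * b)) * (\<kappa> - 1) = 2 * \<i> * c * \<kappa>"
    using c by (simp add: a_def b_def)
  moreover have "(2 * \<i> * a - c * (2 * \<i> * b)) * (\<kappa> - 1) = 2 * \<i> * ((a - c * b) * (\<kappa> - 1))"
    by (simp add: algebra_simps)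
  ultimately have "2 * \<i> * ((a - c * b) * (\<kappa> - 1)) = 2 * \<i> * (c * \<kappa>)"
    by (simp only: mult.assoc)
  then have ab: "(a - c * b) * (\<kappa> - 1) = c * \<kappa>" by simp
  \<comment> \<open>the coefficients of gp and gm in u - c g(z) modulo the domain of Adot are s and - s \<kappa>\<close>
  define s where "s = a - c * b - c"
  have s: "s * \<kappa> = a - c * b" using ab by (simp add: s_def algebra_simps)
  define u0 v0 where "u0 = u - a *\<^sub>C (gp - gm)" and "v0 = v - b *\<^sub>C (gp - gm)"
  obtain u0' v0' where 0: "(u0, u0') \<in> Ahat" "(v0, v0') \<in> Ahat"
    using domain_decomposition[OF u] domain_decomposition[OF v] hat_ext
    unfolding u0_def v0_def a_def b_def by blast
  obtain k where k: "(gp - \<kappa> *\<^sub>C gm, k) \<in> Ahat" using hat_gp by blast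
  have "(s *\<^sub>C (gp - \<kappa> *\<^sub>C gm) + (u0 - c *\<^sub>C v0), s *\<^sub>C k + (u0' - c *\<^sub>C v0')) \<in> Ahat"
    by (intro linear_operator_comb linear_operator_diff linear_operator_scale hat_linear 0 k)
  moreover have "s *\<^sub>C (gp - \<kappa> *\<^sub>C gm) + (u0 - c *\<^sub>C v0) = u - c *\<^sub>C d"
    unfolding complex_vector.scale_right_diff_distrib[of s] scaleC_scaleC s
    by (simp add: u0_def v0_def d s_def scaleC_simps algebra_simps)
  ultimately have hat: "(u - c *\<^sub>C d, s *\<^sub>C k + (u0' - c *\<^sub>C v0')) \<in> Ahat" by simp
  moreover have "(u - c *\<^sub>C d, u' - c *\<^sub>C (z *\<^sub>C d)) \<in> adjoint Adot"
    using u ext_adjoint deficiency_vector_mem[OF z]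
    by (intro adjoint_diff adjoint_scale) (auto simp: d_def deficiency_space_def)
  ultimately have "s *\<^sub>C k + (u0' - c *\<^sub>C v0') = u' - c *\<^sub>C (z *\<^sub>C d)"
    using adjoint_unique[OF dot_dense] hat_adjoint by blast
  with hat show ?thesis by (simp add: d_def)
qed

text \<open>Where the denominator vanishes, the condition of the previous lemma holds with u = 0 and c = 1, so
  g(z) is an eigenvector of Ahat for z.\<close>

lemma krein_denominator_nonzero:
  assumes z: "z \<in> resolvent_set A" and hat: "z \<in> resolvent_set Ahat"
  shows "weyl_titchmarsh A gp z + \<i> * ((\<kappa> + 1) / (\<kappa> - 1)) \<noteq> 0"
proof
  assume 0: "weyl_titchmarsh A gp z + \<i> * ((\<kappa> + 1) / (\<kappa> - 1)) = 0"
  define d where "d = deficiency_vector A gp z"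
  have \<kappa>1: "\<kappa> - 1 \<noteq> 0" using \<kappa> by simp
  have "(weyl_titchmarsh A gp z + \<i> * ((\<kappa> + 1) / (\<kappa> - 1))) * (\<kappa> - 1)
      = weyl_titchmarsh A gp z * (\<kappa> - 1) + \<i> * (\<kappa> + 1)"
    using \<kappa>1 by (simp add: distrib_right)
  with 0 have "weyl_titchmarsh A gp z * (\<kappa> - 1) = - (\<i> * (\<kappa> + 1))"
    by (simp add: eq_neg_iff_add_eq_0)
  then have c: "(cinner (0 + \<i> *\<^sub>C 0) gp - 1 * (weyl_titchmarsh A gp z - \<i>)) * (\<kappa> - 1) = 2 * \<i> * 1 * \<kappa>"
    by (simp add: algebra_simps)
  have "(0, 0) \<in> A" using sa_linear[OF sa] by (simp add: linear_operator_def)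
  from mem_hat[OF z this c] have "(- d, z *\<^sub>C (- d)) \<in> Ahat"
    by (simp add: d_def scaleC_one)
  then have "- d = 0" by (rule eigenvector_eq_0[OF hat _ hat_linear])
  with deficiency_vector_nonzero[OF z] show False by (simp add: d_def)
qed

text \<open>With u = (A - z)^{-1} f the boundary value ((A + i)u, gp) equals (f, g(cnj z)), and the condition
  on c becomes c times the denominator equals (f, g(cnj z)).\<close>

lemma krein_formula:
  assumes z: "z \<in> resolvent_set A" and hat: "z \<in> resolvent_set Ahat"
  shows "resolvent Ahat z f = resolvent A z f -
    (inverse (weyl_titchmarsh A gp z + \<i> * ((\<kappa> + 1) / (\<kappa> - 1)))
      * cinner f (deficiency_vector A gp (cnj z))) *\<^sub>C deficiency_vector A gp z"
proof -
  define N where "N = weyl_titchmarsh A gp z + \<i> * ((\<kappa> + 1) / (\<kappa> - 1))"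
  define e where "e = cinner f (deficiency_vector A gp (cnj z))"
  define u where "u = resolvent A z f"
  define d where "d = deficiency_vector A gp z"
  have N: "N \<noteq> 0" unfolding N_def by (rule krein_denominator_nonzero[OF assms])
  have u: "(u, f + z *\<^sub>C u) \<in> A" unfolding u_def by (rule resolvent_in_graph[OF z])
  have "cinner u gp = cinner f (resolvent A (cnj z) gp)"
    unfolding u_def by (rule sa_resolvent_adjoint[OF sa z])
  then have e: "cinner ((f + z *\<^sub>C u) + \<i> *\<^sub>C u) gp = e"
    by (simp add: e_def deficiency_vector_def cinner_linear algebra_simps)
  have \<kappa>1: "\<kappa> - 1 \<noteq> 0" using \<kappa> by simp
  have NM: "(N - (weyl_titchmarsh A gp z - \<i>)) * (\<kappa> - 1) = \<i> * (\<kappa> + 1) + \<i> * (\<kappa> - 1)"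
    using \<kappa>1 by (simp add: N_def distrib_right left_diff_distrib)
  define q where "q = inverse N * e"
  have "e = q * N" using N by (simp add: q_def)
  then have "(e - q * (weyl_titchmarsh A gp z - \<i>)) * (\<kappa> - 1)
      = q * ((N - (weyl_titchmarsh A gp z - \<i>)) * (\<kappa> - 1))"
    by (simp add: algebra_simps)
  also have "\<dots> = 2 * \<i> * q * \<kappa>" unfolding NM by (simp add: algebra_simps)
  finally have "(e - inverse N * e * (weyl_titchmarsh A gp z - \<i>)) * (\<kappa> - 1) = 2 * \<i> * (inverse N * e) * \<kappa>"
    by (simp only: q_def)
  then have "(u - (inverse N * e) *\<^sub>C d, f + z *\<^sub>C u - (inverse N * e) *\<^sub>C (z *\<^sub>C d)) \<in> Ahat"
    unfolding d_def by (intro mem_hat[OF z u]) (simp only: e)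
  then have "resolvent Ahat z f = u - (inverse N * e) *\<^sub>C d"
    by (rule resolvent_eqI[OF hat]) (simp add: scaleC_simps mult_ac)
  then show ?thesis by (simp add: u_def N_def e_def d_def)
qed

end

end

theorem corollary5p4:
  fixes Adot A Ahat :: "'a::complex_hilbert_space opgraph"
    and gp gm :: 'a
    and \<kappa> :: complex
  assumes "symmetric_operator Adot" and "closed Adot"
    and "has_deficiency_indices Adot 1 1"
    and "maximal_dissipative_extension Adot Ahat" and "Ahat \<noteq> adjoint Ahat"
    and "self_adjoint A" and "Adot \<subseteq> A"
    and "gp \<in> deficiency_space Adot \<i>" and "gm \<in> deficiency_space Adot (- \<i>)"
    and "norm gp = 1" and "norm gm = 1"
    and "gp - gm \<in> Domain A"
    and "cmod \<kappa> < 1" and "gp - \<kappa> *\<^sub>C gm \<in> Domain Ahat"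
  shows "\<exists>(p :: complex \<Rightarrow> complex) (g :: complex \<Rightarrow> 'a) (\<mu> :: real measure).
    (\<forall>z \<in> resolvent_set Ahat \<inter> resolvent_set A. \<forall>f.
       resolvent Ahat z f = resolvent A z f - (p z * cinner f (g (cnj z))) *\<^sub>C g z) \<and>
    (\<forall>z \<in> resolvent_set Ahat \<inter> resolvent_set A.
       weyl_titchmarsh A gp z + \<i> * ((\<kappa> + 1) / (\<kappa> - 1)) \<noteq> 0 \<and>
       p z = inverse (weyl_titchmarsh A gp z + \<i> * ((\<kappa> + 1) / (\<kappa> - 1)))) \<and>
    (\<forall>z \<in> resolvent_set Ahat \<inter> resolvent_set A.
       Im z > 0 \<or> \<not> livsic_infinite Adot gp z \<longrightarrow>
       livsic Adot gp gm z \<noteq> 1 \<and>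
       (livsic Adot gp gm z + 1) / (livsic Adot gp gm z - 1) - (\<kappa> + 1) / (\<kappa> - 1) \<noteq> 0 \<and>
       p z = \<i> * inverse ((livsic Adot gp gm z + 1) / (livsic Adot gp gm z - 1)
                            - (\<kappa> + 1) / (\<kappa> - 1))) \<and>
    \<comment> \<open>where s is infinite, (s + 1) / (s - 1) takes the value 1\<close>
    (\<forall>z \<in> resolvent_set Ahat \<inter> resolvent_set A.
       livsic_infinite Adot gp z \<longrightarrow> p z = \<i> * inverse (1 - (\<kappa> + 1) / (\<kappa> - 1))) \<and>
    (\<forall>z \<in> resolvent_set A.
       g z \<in> deficiency_space Adot z \<and>
       integrable \<mu> (\<lambda>t. 1 / (cmod (of_real t - z))\<^sup>2) \<and>
       norm (g z) = sqrt (LINT t|\<mu>. 1 / (cmod (of_real t - z))\<^sup>2)) \<and>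
    vector_analytic_on g (resolvent_set Ahat \<inter> resolvent_set A) \<and>
    herglotz_nevanlinna_measure (resolvent_set A) (weyl_titchmarsh A gp) \<mu> \<and>
    g \<i> - g (- \<i>) \<in> Domain A \<and> g \<i> - \<kappa> *\<^sub>C g (- \<i>) \<in> Domain Ahat"
proof -
  note sa = \<open>self_adjoint A\<close> and n = \<open>norm gp = 1\<close>
  have dim: "has_cdim (deficiency_space Adot \<i>) 1"
    using assms(3) by (simp add: has_deficiency_indices_def)
  note pair = assms(1,2) dim assms(6-10,12)
  have hat: "linear_operator Ahat" "Adot \<subseteq> Ahat" "Ahat \<subseteq> adjoint Adot"
    using assms(4) by (simp_all add: maximal_dissipative_extension_def maximal_dissipative_def dissipative_def)
  have \<kappa>: "\<kappa> \<noteq> 1" using assms(13) by auto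
  note hats = hat \<kappa> assms(14)
  define M where "M = weyl_titchmarsh A gp"
  define K where "K = (\<kappa> + 1) / (\<kappa> - 1)"
  define p where "p z = inverse (M z + \<i> * K)" for z
  define g where "g = deficiency_vector A gp"
  obtain \<nu> where \<nu>: "real_distribution \<nu>"
    "\<And>z. 0 < Im z \<Longrightarrow> weyl_titchmarsh A gp z = (LINT t|\<nu>. z + (1 + z\<^sup>2) / (of_real t - z))"
    by (rule weyl_titchmarsh_upper_integral[OF sa n]) blast
  define \<mu> where "\<mu> = density \<nu> (\<lambda>t. ennreal (1 + t\<^sup>2))"
  have herglotz: "herglotz_nevanlinna_measure (resolvent_set A) (weyl_titchmarsh A gp) \<mu>"
    unfolding \<mu>_def
    by (rule herglotz_nevanlinna_density(1)[OF sa n \<nu>(1) _ gp_notin[OF pair]]) (rule \<nu>(2))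
  have norms: "has_bochner_integral \<mu> (\<lambda>t. 1 / (cmod (of_real t - z))\<^sup>2)
      ((norm (deficiency_vector A gp z))\<^sup>2)" if "z \<in> resolvent_set A" for z
    unfolding \<mu>_def
    by (rule herglotz_nevanlinna_density(2)[OF sa n \<nu>(1) _ gp_notin[OF pair] that]) (rule \<nu>(2))
  have nonzero: "M z + \<i> * K \<noteq> 0" if "z \<in> resolvent_set Ahat \<inter> resolvent_set A" for z
    using that krein_denominator_nonzero[OF pair hats, of z] by (simp add: M_def K_def)
  have p_alt: "p z = \<i> * inverse (\<i> * M z - K)" "\<i> * M z - K \<noteq> 0"
    if "z \<in> resolvent_set Ahat \<inter> resolvent_set A" for z
  proof -
    have eq: "\<i> * M z - K = \<i> * (M z + \<i> * K)" by (simp add: algebra_simps)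
    show "\<i> * M z - K \<noteq> 0" unfolding eq using nonzero[OF that] by simp
    show "p z = \<i> * inverse (\<i> * M z - K)"
      unfolding eq inverse_mult_distrib p_def by simp
  qed
  have inf: "livsic_infinite Adot gp z \<longleftrightarrow> M z + \<i> = 0" if "z \<in> resolvent_set A" for z
    using livsic_weyl_titchmarsh(1)[OF pair that] by (simp add: M_def)
  have fin: "livsic Adot gp gm z \<noteq> 1"
    "(livsic Adot gp gm z + 1) / (livsic Adot gp gm z - 1) = \<i> * M z"
    if "z \<in> resolvent_set A" "\<not> livsic_infinite Adot gp z" for z
  proof -
    have s: "livsic Adot gp gm z = (M z - \<i>) / (M z + \<i>)"
      using livsic_weyl_titchmarsh(2)[OF pair that] by (simp add: M_def)
    have nz: "M z + \<i> \<noteq> 0" using that inf by simp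
    have 1: "livsic Adot gp gm z - 1 = (- 2 * \<i>) / (M z + \<i>)"
      and 2: "livsic Adot gp gm z + 1 = 2 * M z / (M z + \<i>)"
      unfolding s using nz by (simp_all add: field_simps)
    have "livsic Adot gp gm z - 1 \<noteq> 0" unfolding 1 using nz by simp
    then show "livsic Adot gp gm z \<noteq> 1" by simp
    show "(livsic Adot gp gm z + 1) / (livsic Adot gp gm z - 1) = \<i> * M z"
    proof (rule nonzero_divide_eq_eq[THEN iffD2])
      show "livsic Adot gp gm z + 1 = \<i> * M z * (livsic Adot gp gm z - 1)"
      proof -
        have "\<i> * M z * (- 2 * \<i>) = 2 * M z" by (simp add: algebra_simps)
        then show ?thesis by (simp only: 1 2 times_divide_eq_right)
      qed
    qed fact
  qed
  have upper: "\<not> livsic_infinite Adot gp z" if "z \<in> resolvent_set A" "0 < Im z" for z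
  proof
    assume "livsic_infinite Adot gp z"
    then have "Im (M z) = - 1" using inf[OF that(1)] by (simp add: complex_eq_iff)
    moreover have "0 \<le> Im (M z)"
      using weyl_titchmarsh_Im[OF sa that(1) n] that(2) by (simp add: M_def)
    ultimately show False by simp
  qed
  have gi: "g \<i> = gp" "g (- \<i>) = gm"
    using gm_deficiency_vector[OF pair] by (simp_all add: g_def deficiency_vector_def)
  have "vector_analytic_on g (resolvent_set Ahat \<inter> resolvent_set A)"
    unfolding vector_analytic_on_def g_def using deficiency_vector_derivative[OF sa] by blast
  moreover have "g z \<in> deficiency_space Adot z \<and> integrable \<mu> (\<lambda>t. 1 / (cmod (of_real t - z))\<^sup>2) \<and>
      norm (g z) = sqrt (LINT t|\<mu>. 1 / (cmod (of_real t - z))\<^sup>2)" if "z \<in> resolvent_set A" for z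
    using norms[OF that] deficiency_vector_mem[OF pair that]
    by (simp add: g_def has_bochner_integral_iff)
  moreover have "resolvent Ahat z f = resolvent A z f - (p z * cinner f (g (cnj z))) *\<^sub>C g z"
    if "z \<in> resolvent_set Ahat \<inter> resolvent_set A" for z f
    using krein_formula[OF pair hats, of z f] that by (simp add: p_def M_def K_def g_def)
  moreover have "livsic Adot gp gm z \<noteq> 1 \<and>
       (livsic Adot gp gm z + 1) / (livsic Adot gp gm z - 1) - K \<noteq> 0 \<and>
       p z = \<i> * inverse ((livsic Adot gp gm z + 1) / (livsic Adot gp gm z - 1) - K)"
    if "z \<in> resolvent_set Ahat \<inter> resolvent_set A" "Im z > 0 \<or> \<not> livsic_infinite Adot gp z" for z
  proof -
    have z: "z \<in> resolvent_set A" "\<not> livsic_infinite Adot gp z" using that upper by auto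
    show ?thesis unfolding fin(2)[OF z] using fin(1)[OF z] p_alt[OF that(1)] by blast
  qed
  moreover have "p z = \<i> * inverse (1 - K)"
    if "z \<in> resolvent_set Ahat \<inter> resolvent_set A" "livsic_infinite Adot gp z" for z
  proof -
    have "M z = - \<i>" using inf[of z] that by (simp add: eq_neg_iff_add_eq_0)
    with p_alt(1)[OF that(1)] show ?thesis by simp
  qed
  ultimately show ?thesis
    using nonzero herglotz gi assms(12,14)
    unfolding M_def[symmetric] K_def[symmetric]
    by (intro exI[of _ p] exI[of _ g] exI[of _ \<mu>] conjI) (simp_all add: p_def)
qed

end
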